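(* For a property of bit strings $\Pi=\{\Pi_n\}_{n\in\mathbb{N}}$ with $\Pi_n\subseteq\{0,1\}^n$, let $\mathcal{D}_\Pi=\{\mathcal{D}_n\}_{n\in\mathbb{N}}$ where $\mathcal{D}_n$ is the set of all distributions over $\{0,1\}^n$ whose support is a subset of $\Pi_n$. If the query complexity of testing $\Pi$ is $q$, then the query complexity of testing $\mathcal{D}_\Pi$ in the DoHO model is at most $q'$ with $q'(n,\epsilon)=\widetilde{O}(1/\epsilon)\cdot q(n,\epsilon/2)$. Furthermore, if $q(n,\epsilon)\ge 2^c\cdot q(n,2\epsilon)$ holds for some constant $c\ge1$ and all $\epsilon\in[O(1/n),\Omega(1)]$, then $q'(n,\epsilon)=O(q(n,\epsilon))$ if $c>1$, and $q'(n,\epsilon)=O(\log(1/\epsilon))^3\cdot q(n,\epsilon)$ if $c=1$. In both cases the tester uses $O(1/\epsilon)$ samples.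
   Context: For $x,y\in\{0,1\}^n$ let $\Delta_H(x,y)=\frac1n|\{i:x_i\neq y_i\}|$. A tester for the string property $\Pi$ with query complexity $q$ is an oracle machine that on input $n,\epsilon$ and oracle access to $x\in\{0,1\}^n$ makes at most $q(n,\epsilon)$ queries, accepts with probability at least $2/3$ if $x\in\Pi_n$, and rejects with probability at least $2/3$ if $\Delta_H(x,z)>\epsilon$ for all $z\in\Pi_n$. The distance between distributions $P,Q$ over $\{0,1\}^n$ is $\min\sum_{x,y}w_{x,y}\Delta_H(x,y)$ over nonnegative $w_{x,y}$ with $\sum_y w_{x,y}=P(x)$, $\sum_x w_{x,y}=Q(y)$; $P$ is $\epsilon$-far from a set if its distance to each member exceeds $\epsilon$. A tester in the DoHO model for $\mathcal{D}_\Pi$ gets $n,\epsilon$ and oracle access to independent samples of an unknown distribution $P$ over $\{0,1\}^n$, may query individual bits of samples, and must accept with probability at least $2/3$ if $P\in\mathcal{D}_n$ and reject with probability at least $2/3$ if $P$ is $\epsilon$-far from $\mathcal{D}_n$; its query complexity is the total number of bit queries.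
   Formalization: In the "furthermore" part, q'=O(q(n,ε)) (times log^3 if c=1) is claimed for ε in [a/n,b] and assumes q(n,ρε)=O(q(n,ε)) for some constant ρ<1; without this, the bound uses max(q(n,ε),q(n,ρε)) for any constant ρ<1, since the literal bound fails when q jumps. *)

theory Defs
  imports "HOL-Probability.Probability"
begin

definition strings :: "nat \<Rightarrow> bool list set" where
  "strings n = {x. length x = n}"

definition hamming_dist :: "nat \<Rightarrow> bool list \<Rightarrow> bool list \<Rightarrow> real" where
  "hamming_dist n x y = real (card {i. i < n \<and> x ! i \<noteq> y ! i}) / real n"

(* A deterministic adaptive query algorithm: "Query i t0 t1" asks the oracle for the bit with
   address i and continues with t0 or t1 if the answer is False or True, respectively.  A
   randomized machine is, for each input (n, eps), a distribution over such trees; no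
   computability or running-time requirement is imposed. *)
datatype 'i qtree = Answer bool | Query 'i "'i qtree" "'i qtree"

fun run :: "'i qtree \<Rightarrow> ('i \<Rightarrow> bool) \<Rightarrow> bool" where
  "run (Answer b) f = b"
| "run (Query i t0 t1) f = run (if f i then t1 else t0) f"

fun num_queries :: "'i qtree \<Rightarrow> ('i \<Rightarrow> bool) \<Rightarrow> nat" where
  "num_queries (Answer b) f = 0"
| "num_queries (Query i t0 t1) f = Suc (num_queries (if f i then t1 else t0) f)"

(* Addresses beyond the end of the string are answered by False, and still count as queries. *)
definition bit_oracle :: "bool list \<Rightarrow> nat \<Rightarrow> bool" where
  "bit_oracle x i \<longleftrightarrow> i < length x \<and> x ! i"

definition string_tester ::
    "(nat \<Rightarrow> bool list set) \<Rightarrow> (nat \<Rightarrow> real \<Rightarrow> nat) \<Rightarrow> (nat \<Rightarrow> real \<Rightarrow> nat qtree pmf) \<Rightarrow> bool" where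
  "string_tester \<Phi> q T \<longleftrightarrow> (\<forall>n>0. \<forall>\<epsilon>\<in>{0<..<1}.
     (\<forall>t\<in>set_pmf (T n \<epsilon>). \<forall>x\<in>strings n. num_queries t (bit_oracle x) \<le> q n \<epsilon>) \<and>
     (\<forall>x\<in>\<Phi> n. measure_pmf.prob (T n \<epsilon>) {t. run t (bit_oracle x)} \<ge> 2 / 3) \<and>
     (\<forall>x\<in>strings n. (\<forall>z\<in>\<Phi> n. hamming_dist n x z > \<epsilon>) \<longrightarrow>
        measure_pmf.prob (T n \<epsilon>) {t. \<not> run t (bit_oracle x)} \<ge> 2 / 3))"

definition dists_over :: "nat \<Rightarrow> bool list pmf set" where
  "dists_over n = {P. set_pmf P \<subseteq> strings n}"

definition couplings ::
    "nat \<Rightarrow> bool list pmf \<Rightarrow> bool list pmf \<Rightarrow> (bool list \<Rightarrow> bool list \<Rightarrow> real) set" where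
  "couplings n P Q = {w. (\<forall>x\<in>strings n. \<forall>y\<in>strings n. w x y \<ge> 0) \<and>
     (\<forall>x\<in>strings n. (\<Sum>y\<in>strings n. w x y) = pmf P x) \<and>
     (\<forall>y\<in>strings n. (\<Sum>x\<in>strings n. w x y) = pmf Q y)}"

(* The infimum is a minimum: the couplings, restricted to the finitely many relevant entries,
   form a nonempty compact set. *)
definition dist_distance :: "nat \<Rightarrow> bool list pmf \<Rightarrow> bool list pmf \<Rightarrow> real" where
  "dist_distance n P Q =
     (INF w\<in>couplings n P Q. \<Sum>x\<in>strings n. \<Sum>y\<in>strings n. w x y * hamming_dist n x y)"

(* The bit with address (j, i) is the i-th bit of the j-th sample. *)
definition sample_oracle :: "(nat \<Rightarrow> bool list) \<Rightarrow> nat \<times> nat \<Rightarrow> bool" where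
  "sample_oracle \<omega> = (\<lambda>(j, i). bit_oracle (\<omega> j) i)"

(* m independent samples of P, numbered from 0; there are no further samples, which is encoded
   by the empty string (so queries to them carry no information). *)
definition samples :: "nat \<Rightarrow> bool list pmf \<Rightarrow> (nat \<Rightarrow> bool list) pmf" where
  "samples m P = Pi_pmf {..<m} [] (\<lambda>_. P)"

(* q bounds the total number of bit queries and s is the number of samples.  The coins of the
   machine are independent of the samples. *)
definition doho_tester ::
    "(nat \<Rightarrow> bool list pmf set) \<Rightarrow> (nat \<Rightarrow> real \<Rightarrow> nat) \<Rightarrow> (nat \<Rightarrow> real \<Rightarrow> nat) \<Rightarrow>
     (nat \<Rightarrow> real \<Rightarrow> (nat \<times> nat) qtree pmf) \<Rightarrow> bool" where
  "doho_tester \<D> q s T \<longleftrightarrow> (\<forall>n>0. \<forall>\<epsilon>\<in>{0<..<1}.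
     (\<forall>t\<in>set_pmf (T n \<epsilon>). \<forall>\<omega>\<in>PiE_dflt {..<s n \<epsilon>} [] (\<lambda>_. strings n).
        num_queries t (sample_oracle \<omega>) \<le> q n \<epsilon>) \<and>
     (\<forall>P\<in>\<D> n.
        measure_pmf.prob (pair_pmf (T n \<epsilon>) (samples (s n \<epsilon>) P))
          {(t, \<omega>). run t (sample_oracle \<omega>)} \<ge> 2 / 3) \<and>
     (\<forall>P\<in>dists_over n. (\<forall>Q\<in>\<D> n. dist_distance n P Q > \<epsilon>) \<longrightarrow>
        measure_pmf.prob (pair_pmf (T n \<epsilon>) (samples (s n \<epsilon>) P))
          {(t, \<omega>). \<not> run t (sample_oracle \<omega>)} \<ge> 2 / 3))"

definition supported_dists :: "(nat \<Rightarrow> bool list set) \<Rightarrow> nat \<Rightarrow> bool list pmf set" where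
  "supported_dists \<Phi> n = {P \<in> dists_over n. set_pmf P \<subseteq> \<Phi> n}"

(* Some tester for \<D> has query complexity O(B n eps) for all (n, eps) in R and uses O(1/eps)
   samples (for all n and eps); the implied constants do not depend on n and eps. *)
definition doho_testable ::
    "(nat \<Rightarrow> bool list pmf set) \<Rightarrow> (nat \<times> real) set \<Rightarrow> (nat \<Rightarrow> real \<Rightarrow> real) \<Rightarrow> bool" where
  "doho_testable \<D> R B \<longleftrightarrow> (\<exists>q' s T K.
     doho_tester \<D> q' s T \<and>
     (\<forall>(n, \<epsilon>)\<in>R. real (q' n \<epsilon>) \<le> K * B n \<epsilon>) \<and>
     (\<forall>n>0. \<forall>\<epsilon>\<in>{0<..<1}. real (s n \<epsilon>) \<le> K / \<epsilon>))"

definition eps_range :: "real \<Rightarrow> real \<Rightarrow> (nat \<times> real) set" where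
  "eps_range a b = {(n, \<epsilon>). n > 0 \<and> a / real n \<le> \<epsilon> \<and> \<epsilon> \<le> b}"

(* The condition q(n,eps) >= 2^c * q(n,2*eps) bounds the growth of q only from below.  If q may
   jump at eps by an unbounded factor, then O(q(n,eps)) queries do not suffice at that same eps:
   a distribution can have average distance just above eps to the property although almost all
   of its mass has distance at most eps.  For this reason a bound in terms of q n eps is
   combined with q n (rho * eps), where rho < 1 is an arbitrary constant.  If q varies by at most
   a constant factor between rho * eps and eps, as for the usual complexity bounds, then this
   means O(q(n,eps)). *)
definition q_near :: "(nat \<Rightarrow> real \<Rightarrow> nat) \<Rightarrow> real \<Rightarrow> nat \<Rightarrow> real \<Rightarrow> real" where
  "q_near q \<rho> n \<epsilon> = max (real (q n \<epsilon>)) (real (q n (\<rho> * \<epsilon>)))"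

end

theory Submission
  imports Defs
begin

text \<open>Take a list of pairs \<open>(\<delta>, k)\<close>, draw one fresh sample for each of them, test it for proximity
  \<open>\<delta>\<close> by a majority of \<open>k\<close> runs of the given tester, and accept if all these tests accept.  The
  acceptance probability is then a product over the samples, so a distribution is rejected as soon
  as the expected number of samples that are farther from the property than their own \<open>\<delta>\<close> is at
  least 2.  If the average distance exceeds \<open>\<epsilon>\<close>, this holds for \<open>4 / \<epsilon>\<close> samples with
  \<open>\<delta> = \<epsilon> / 2\<close>, but also for \<open>O(1)\<close> samples with \<open>\<delta> = \<rho> \<epsilon>\<close> together with \<open>O(2\<^sup>i)\<close> samples for each
  \<open>\<delta> = 2\<^sup>i \<epsilon>\<close>, which are cheap at large \<open>\<delta>\<close> if \<open>q\<close> grows at least linearly in \<open>1 / \<epsilon>\<close>.\<close>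

section \<open>Sequential composition of query trees\<close>

fun bind_qtree :: "'i qtree \<Rightarrow> (bool \<Rightarrow> 'i qtree) \<Rightarrow> 'i qtree" where
  "bind_qtree (Answer b) k = k b"
| "bind_qtree (Query i t0 t1) k = Query i (bind_qtree t0 k) (bind_qtree t1 k)"

lemma run_bind_qtree: "run (bind_qtree t k) f = run (k (run t f)) f"
  by (induction t) auto

lemma num_queries_bind_qtree:
  "num_queries (bind_qtree t k) f = num_queries t f + num_queries (k (run t f)) f"
  by (induction t) auto

fun combine :: "'i qtree list \<Rightarrow> (bool list \<Rightarrow> bool) \<Rightarrow> 'i qtree" where
  "combine [] V = Answer (V [])"
| "combine (t # ts) V = bind_qtree t (\<lambda>b. combine ts (\<lambda>bs. V (b # bs)))"

lemma run_combine: "run (combine ts V) f = V (map (\<lambda>t. run t f) ts)"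
  by (induction ts arbitrary: V) (auto simp: run_bind_qtree)

lemma num_queries_combine: "num_queries (combine ts V) f = (\<Sum>t\<leftarrow>ts. num_queries t f)"
  by (induction ts arbitrary: V) (auto simp: num_queries_bind_qtree)

lemma run_map_qtree: "run (map_qtree h t) f = run t (f \<circ> h)"
  by (induction t) auto

lemma num_queries_map_qtree: "num_queries (map_qtree h t) f = num_queries t (f \<circ> h)"
  by (induction t) auto

lemma sample_oracle_Pair: "sample_oracle \<omega> \<circ> Pair j = bit_oracle (\<omega> j)"
  by (auto simp: sample_oracle_def)

section \<open>Error reduction by majority vote\<close>

definition majority :: "nat \<Rightarrow> (nat \<Rightarrow> 'i qtree) \<Rightarrow> 'i qtree" where
  "majority k \<tau> = combine (map \<tau> [0..<k]) (\<lambda>bs. k < 2 * length (filter (\<lambda>b. b) bs))"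

definition amplify :: "nat \<Rightarrow> 'i qtree pmf \<Rightarrow> 'i qtree pmf" where
  "amplify k A = map_pmf (majority k) (Pi_pmf {..<k} (Answer False) (\<lambda>_. A))"

lemma run_majority: "run (majority k \<tau>) f \<longleftrightarrow> k < 2 * card {i. i < k \<and> run (\<tau> i) f}"
proof -
  have "length (filter (\<lambda>i. run (\<tau> i) f) [0..<k]) = card {i. i < k \<and> run (\<tau> i) f}"
    by (subst length_filter_conv_card) (auto intro!: arg_cong[where f = card])
  thus ?thesis
    by (simp add: majority_def run_combine filter_map comp_def)
qed

text \<open>This is 2 sqrt (p (1 - p)) at p = 1/3: the minimum of (1 - p) / t + p t over all weights
  t > 0, attained at t = sqrt 2.\<close>

definition amp_rate :: real where "amp_rate = 2 * sqrt 2 / 3"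

lemma amp_rate_bounds: "0 < amp_rate" "amp_rate < 1"
proof -
  have "sqrt 2 < 3 / 2" by (rule real_less_lsqrt) (auto simp: power2_eq_square)
  thus "0 < amp_rate" "amp_rate < 1" by (auto simp: amp_rate_def)
qed

lemma expectation_affine_indicator:
  "measure_pmf.expectation P (\<lambda>x. a - c * indicator F x) = a - c * measure_pmf.prob P F"
proof -
  have "integrable (measure_pmf P) (\<lambda>x. c * indicator F x :: real)"
    by (intro integrable_mult_right measure_pmf.integrable_const_bound[where B = 1])
       (auto simp: indicator_def)
  thus ?thesis
    by (subst Bochner_Integration.integral_diff) auto
qed

text \<open>Exponential Markov inequality: a wrong majority forces at least as many wrong as right
  runs, so the product of the weights below is at least 1, while each factor has expectation at
  most \<open>2/3 \<cdot> 1 / \<surd>2 + 1/3 \<cdot> \<surd>2 = amp_rate\<close>.\<close>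
lemma amplify_error:
  assumes "measure_pmf.prob A {t. run t f = v} \<ge> 2 / 3"
  shows "measure_pmf.prob (amplify k A) {t. run t f \<noteq> v} \<le> amp_rate ^ k"
proof -
  define h where "h t = (if run t f = v then 1 / sqrt 2 else sqrt 2)" for t :: "'a qtree"
  let ?M = "Pi_pmf {..<k} (Answer False) (\<lambda>_. A)"
  have h_int: "integrable (measure_pmf A) h"
    by (rule measure_pmf.integrable_const_bound[where B = "sqrt 2"])
       (auto simp: h_def field_simps)
  have h_exp: "measure_pmf.expectation A h \<le> amp_rate"
  proof -
    define p where "p = measure_pmf.prob A {t. run t f = v}"
    \<comment> \<open>Written as an affine function of the indicator, \<open>h\<close> has an
      expectation that decreases in the success probability, so a lower bound of 2/3 on the latter
      is enough.\<close>
    have "h t = sqrt 2 - (sqrt 2 / 2) * indicator {t. run t f = v} t" for t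
      by (auto simp: h_def indicator_def field_simps)
    hence "measure_pmf.expectation A h =
        measure_pmf.expectation A (\<lambda>t. sqrt 2 - (sqrt 2 / 2) * indicator {t. run t f = v} t)"
      by (intro Bochner_Integration.integral_cong) auto
    also have "\<dots> = sqrt 2 - (sqrt 2 / 2) * p"
      unfolding p_def by (rule expectation_affine_indicator)
    also have "\<dots> \<le> sqrt 2 - (sqrt 2 / 2) * (2 / 3)"
      using assms unfolding p_def[symmetric] by (intro diff_left_mono mult_left_mono) auto
    also have "\<dots> = amp_rate" by (simp add: amp_rate_def)
    finally show ?thesis .
  qed
  have wrong: "indicator {\<tau>. run (majority k \<tau>) f \<noteq> v} \<tau> \<le> (\<Prod>i<k. h (\<tau> i))" for \<tau>
  proof (cases "run (majority k \<tau>) f = v")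
    case True
    thus ?thesis by (auto simp: h_def intro!: prod_nonneg)
  next
    case False
    define G where "G = {i. i < k \<and> run (\<tau> i) f = v}"
    define B where "B = {i. i < k \<and> run (\<tau> i) f \<noteq> v}"
    have disj: "{..<k} = G \<union> B" "G \<inter> B = {}" "finite G" "finite B" by (auto simp: G_def B_def)
    have sum: "card G + card B = k" using disj card_Un_disjoint[of G B] by (metis card_lessThan)
    \<comment> \<open>A tie makes the majority answer False. Hence equality can occur for
      \<open>v = True\<close>, while for \<open>v = False\<close> the wrong runs strictly outnumber
      the right ones.\<close>
    have le: "card G \<le> card B"
    proof (cases v)
      case True
      thus ?thesis using False sum by (auto simp: run_majority G_def B_def)
    next
      case f: False
      thus ?thesis using False sum by (auto simp: run_majority G_def B_def)
    qed
    have "(\<Prod>i<k. h (\<tau> i)) = (\<Prod>i\<in>G. h (\<tau> i)) * (\<Prod>i\<in>B. h (\<tau> i))"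
      using disj by (simp add: prod.union_disjoint)
    also have "(\<Prod>i\<in>G. h (\<tau> i)) = (1 / sqrt 2) ^ card G" by (simp add: G_def h_def)
    also have "(\<Prod>i\<in>B. h (\<tau> i)) = sqrt 2 ^ card B" by (simp add: B_def h_def)
    also have "(1 / sqrt 2) ^ card G * sqrt 2 ^ card B = sqrt 2 ^ (card B - card G)"
      using le by (simp add: power_diff power_divide)
    also have "\<dots> \<ge> 1" by (simp add: one_le_power)
    finally show ?thesis by (simp add: indicator_def)
  qed
  have "measure_pmf.prob (amplify k A) {t. run t f \<noteq> v} =
      measure_pmf.expectation ?M (indicator {\<tau>. run (majority k \<tau>) f \<noteq> v})"
    by (simp add: amplify_def measure_map_pmf vimage_def)
  also have "\<dots> \<le> measure_pmf.expectation ?M (\<lambda>\<tau>. \<Prod>i<k. h (\<tau> i))"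
  proof (rule integral_mono[OF _ _ wrong])
    show "integrable (measure_pmf ?M) (indicator {\<tau>. run (majority k \<tau>) f \<noteq> v} :: _ \<Rightarrow> real)"
      by (rule measure_pmf.integrable_const_bound[where B = 1]) (auto simp: indicator_def)
  qed (intro integrable_prod_Pi_pmf h_int, simp)
  also have "\<dots> = measure_pmf.expectation A h ^ k"
    by (subst expectation_prod_Pi_pmf) (auto simp: h_int, auto simp: h_def)
  also have "\<dots> \<le> amp_rate ^ k"
    by (intro power_mono h_exp Bochner_Integration.integral_nonneg) (auto simp: h_def)
  finally show ?thesis .
qed

lemma num_queries_amplify:
  assumes "t \<in> set_pmf (amplify k A)" and "\<And>t. t \<in> set_pmf A \<Longrightarrow> num_queries t f \<le> q"
  shows "num_queries t f \<le> k * q"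
proof -
  obtain \<tau> where t: "t = majority k \<tau>" and \<tau>: "\<tau> \<in> set_pmf (Pi_pmf {..<k} (Answer False) (\<lambda>_. A))"
    using assms(1) by (auto simp: amplify_def)
  have "num_queries t f = (\<Sum>i<k. num_queries (\<tau> i) f)"
    by (simp add: t majority_def num_queries_combine comp_def interv_sum_list_conv_sum_set_nat
        atLeast0LessThan)
  also have "\<dots> \<le> (\<Sum>i<k. q)"
    using \<tau> by (intro sum_mono assms(2)) (auto simp: set_Pi_pmf PiE_dflt_def)
  finally show ?thesis by simp
qed

section \<open>Independent tests on independent samples\<close>

definition all_accept :: "nat \<Rightarrow> (nat \<Rightarrow> 'i qtree) \<Rightarrow> (nat \<times> 'i) qtree" where
  "all_accept m \<tau> = combine (map (\<lambda>j. map_qtree (Pair j) (\<tau> j)) [0..<m]) (list_all (\<lambda>b. b))"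

definition test_samples :: "nat \<Rightarrow> (nat \<Rightarrow> 'i qtree pmf) \<Rightarrow> (nat \<times> 'i) qtree pmf" where
  "test_samples m A = map_pmf (all_accept m) (Pi_pmf {..<m} (Answer False) A)"

lemma run_all_accept:
  "run (all_accept m \<tau>) (sample_oracle \<omega>) \<longleftrightarrow> (\<forall>j<m. run (\<tau> j) (bit_oracle (\<omega> j)))"
  by (simp add: all_accept_def run_combine list_all_iff run_map_qtree sample_oracle_Pair
      atLeast0LessThan) blast

lemma num_queries_all_accept:
  "num_queries (all_accept m \<tau>) (sample_oracle \<omega>) = (\<Sum>j<m. num_queries (\<tau> j) (bit_oracle (\<omega> j)))"
  by (simp add: all_accept_def num_queries_combine comp_def interv_sum_list_conv_sum_set_nat
        atLeast0LessThan num_queries_map_qtree sample_oracle_Pair[unfolded comp_def])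

definition accept_prob :: "nat qtree pmf \<Rightarrow> bool list pmf \<Rightarrow> real" where
  "accept_prob A P = measure_pmf.prob (pair_pmf A P) {(t, x). run t (bit_oracle x)}"

text \<open>The j-th tree reads only the j-th sample, so the indicator of joint acceptance is a
  product over j. Independence then lets the integral over the samples, and after it the integral
  over the trees, be pulled into this product. Nonnegative integrals make this free of integrability
  conditions.\<close>

lemma accept_prob_test_samples:
  "measure_pmf.prob (pair_pmf (test_samples m A) (samples m P)) {(t, \<omega>). run t (sample_oracle \<omega>)} =
     (\<Prod>j<m. accept_prob (A j) P)"
proof -
  define g where "g = (\<lambda>t x. indicator {(t, x). run t (bit_oracle x)} (t, x) :: ennreal)"
  let ?M = "Pi_pmf {..<m} (Answer False) A"
  have "emeasure (pair_pmf (test_samples m A) (samples m P)) {(t, \<omega>). run t (sample_oracle \<omega>)} =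
      (\<integral>\<^sup>+t. \<integral>\<^sup>+\<omega>. indicator {(t, \<omega>). run t (sample_oracle \<omega>)} (t, \<omega>) \<partial>samples m P \<partial>test_samples m A)"
    by (subst nn_integral_pair_pmf'[symmetric]) simp
  also have "\<dots> = (\<integral>\<^sup>+\<tau>. \<integral>\<^sup>+\<omega>. (\<Prod>j<m. g (\<tau> j) (\<omega> j)) \<partial>samples m P \<partial>?M)"
    unfolding test_samples_def nn_integral_map_pmf
  proof (intro nn_integral_cong)
    fix \<tau> \<omega>
    show "indicator {(t, \<omega>). run t (sample_oracle \<omega>)} (all_accept m \<tau>, \<omega>) = (\<Prod>j<m. g (\<tau> j) (\<omega> j))"
      by (auto simp: g_def indicator_def run_all_accept intro!: prod.neutral)
  qed
  also have "\<dots> = (\<integral>\<^sup>+\<tau>. (\<Prod>j<m. \<integral>\<^sup>+x. g (\<tau> j) x \<partial>P) \<partial>?M)"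
    unfolding samples_def by (subst nn_integral_prod_Pi_pmf) auto
  also have "\<dots> = (\<Prod>j<m. \<integral>\<^sup>+t. \<integral>\<^sup>+x. g t x \<partial>P \<partial>A j)"
    by (subst nn_integral_prod_Pi_pmf) auto
  also have "\<dots> = (\<Prod>j<m. emeasure (pair_pmf (A j) P) {(t, x). run t (bit_oracle x)})"
    unfolding g_def by (subst nn_integral_pair_pmf'[symmetric]) simp
  finally show ?thesis
    by (simp add: measure_pmf.emeasure_eq_measure accept_prob_def prod_ennreal prod_nonneg)
qed

text \<open>Exchanging the order of integration fixes the sample before the coins, which is the
  order in which the guarantees of a string tester can be applied.\<close>

lemma accept_prob_eq_expectation:
  "accept_prob A P = measure_pmf.expectation P (\<lambda>x. measure_pmf.prob A {t. run t (bit_oracle x)})"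
proof -
  let ?S = "{(t, x). run t (bit_oracle x)}"
  have "emeasure (pair_pmf A P) ?S = emeasure (pair_pmf P A) ((\<lambda>(x, y). (y, x)) -` ?S)"
    by (subst pair_commute_pmf) simp
  also have "\<dots> = (\<integral>\<^sup>+x. \<integral>\<^sup>+t. indicator ((\<lambda>(x, y). (y, x)) -` ?S) (x, t) \<partial>A \<partial>P)"
    by (subst nn_integral_pair_pmf'[symmetric]) simp
  also have "\<dots> = (\<integral>\<^sup>+x. emeasure A {t. run t (bit_oracle x)} \<partial>P)"
    by (intro nn_integral_cong, subst nn_integral_indicator[symmetric])
       (auto intro!: nn_integral_cong simp del: nn_integral_indicator simp: indicator_def)
  also have "\<dots> = (\<integral>\<^sup>+x. ennreal (measure_pmf.prob A {t. run t (bit_oracle x)}) \<partial>P)"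
    by (simp add: measure_pmf.emeasure_eq_measure)
  also have "\<dots> = ennreal (measure_pmf.expectation P (\<lambda>x. measure_pmf.prob A {t. run t (bit_oracle x)}))"
    by (intro nn_integral_eq_integral measure_pmf.integrable_const_bound[where B = 1]) auto
  finally show ?thesis
    by (simp add: measure_pmf.emeasure_eq_measure accept_prob_def)
qed

lemma accept_prob_ge:
  assumes "\<And>x. x \<in> set_pmf P \<Longrightarrow> measure_pmf.prob A {t. \<not> run t (bit_oracle x)} \<le> e"
  shows "1 - e \<le> accept_prob A P"
proof -
  have "measure_pmf.expectation P (\<lambda>x. 1 - e) \<le> accept_prob A P"
    unfolding accept_prob_eq_expectation
  proof (intro integral_mono_AE AE_pmfI)
    show "integrable (measure_pmf P) (\<lambda>x. measure_pmf.prob A {t. run t (bit_oracle x)})"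
      by (intro measure_pmf.integrable_const_bound[where B = 1]) auto
  next
    fix x assume "x \<in> set_pmf P"
    moreover have "measure_pmf.prob A {t. run t (bit_oracle x)} =
        1 - measure_pmf.prob A {t. \<not> run t (bit_oracle x)}"
      by (subst measure_pmf.prob_compl[symmetric]) (auto intro!: arg_cong[where f = "measure_pmf.prob A"])
    ultimately show "1 - e \<le> measure_pmf.prob A {t. run t (bit_oracle x)}"
      using assms[of x] by linarith
  qed auto
  thus ?thesis by simp
qed

text \<open>On \<open>F\<close> acceptance loses at least 2/3; elsewhere only the trivial bound 1 is
  used.\<close>

lemma accept_prob_le:
  assumes "\<And>x. x \<in> set_pmf P \<Longrightarrow> x \<in> F \<Longrightarrow> measure_pmf.prob A {t. run t (bit_oracle x)} \<le> 1 / 3"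
  shows "accept_prob A P \<le> 1 - 2 / 3 * measure_pmf.prob P F"
proof -
  have "accept_prob A P \<le> measure_pmf.expectation P (\<lambda>x. 1 - 2 / 3 * indicator F x)"
    unfolding accept_prob_eq_expectation
  proof (intro integral_mono_AE measure_pmf.integrable_const_bound[where B = 1] AE_pmfI)
    fix x assume "x \<in> set_pmf P"
    thus "measure_pmf.prob A {t. run t (bit_oracle x)} \<le> 1 - 2 / 3 * indicator F x"
      using assms[of x] by (auto simp: indicator_def)
  qed (auto simp: indicator_def)
  also have "\<dots> = 1 - 2 / 3 * measure_pmf.prob P F"
    by (rule expectation_affine_indicator)
  finally show ?thesis .
qed

section \<open>Distance to the property and cost of transport\<close>

lemma finite_strings: "finite (strings n)"
  using finite_lists_length_eq[of "UNIV :: bool set" n] by (simp add: strings_def)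

lemma hamming_dist_nonneg: "0 \<le> hamming_dist n x y"
  by (simp add: hamming_dist_def)

lemma hamming_dist_le_1: "hamming_dist n x y \<le> 1"
proof -
  have "card {i. i < n \<and> x ! i \<noteq> y ! i} \<le> card {..<n}" by (intro card_mono) auto
  thus ?thesis by (auto simp: hamming_dist_def divide_le_eq_1)
qed

text \<open>The value 1 for the empty property makes every string far from it at each proximity below 1.\<close>
definition property_dist :: "nat \<Rightarrow> bool list set \<Rightarrow> bool list \<Rightarrow> real" where
  "property_dist n S x = (if S = {} then 1 else Min (hamming_dist n x ` S))"

lemma property_dist_in:
  assumes "finite S" "S \<noteq> {}"
  shows "\<exists>z\<in>S. property_dist n S x = hamming_dist n x z"
proof -
  have "Min (hamming_dist n x ` S) \<in> hamming_dist n x ` S" using assms by (intro Min_in) auto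
  then obtain z where "Min (hamming_dist n x ` S) = hamming_dist n x z" "z \<in> S" by (rule imageE)
  thus ?thesis using assms(2) by (auto simp: property_dist_def)
qed

lemma property_dist_bounds:
  assumes "finite S"
  shows "0 \<le> property_dist n S x" "property_dist n S x \<le> 1"
proof -
  have "0 \<le> property_dist n S x \<and> property_dist n S x \<le> 1"
    using property_dist_in[OF assms, of n x] hamming_dist_nonneg hamming_dist_le_1
    by (cases "S = {}") (auto simp: property_dist_def)
  thus "0 \<le> property_dist n S x" "property_dist n S x \<le> 1" by auto
qed

text \<open>For the empty property the left side is vacuous and the right side reads
  \<open>\<delta> < 1\<close>; otherwise the minimum decides.\<close>

lemma far_iff_property_dist:
  assumes "finite S" "\<delta> < 1"
  shows "(\<forall>z\<in>S. hamming_dist n x z > \<delta>) \<longleftrightarrow> \<delta> < property_dist n S x"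
  using assms by (auto simp: property_dist_def)

lemma integrable_property_dist:
  assumes "finite S"
  shows "integrable (measure_pmf P) (property_dist n S)"
  using property_dist_bounds[OF assms]
  by (intro measure_pmf.integrable_const_bound[where B = 1]) auto

text \<open>Moving each string to a nearest element of the property is a coupling of cost
  \<open>E\<^sub>P property_dist\<close>.\<close>
lemma dist_distance_le_expectation:
  assumes S: "S \<subseteq> strings n" "S \<noteq> {}" and P: "P \<in> dists_over n"
  shows "\<exists>Q\<in>dists_over n. set_pmf Q \<subseteq> S \<and>
           dist_distance n P Q \<le> measure_pmf.expectation P (property_dist n S)"
proof -
  have fin: "finite S" using S finite_strings finite_subset by blast
  obtain z where z: "\<And>x. z x \<in> S" "\<And>x. property_dist n S x = hamming_dist n x (z x)"
    using property_dist_in[OF fin S(2)] by metis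
  define Q where "Q = map_pmf z P"
  define w where "w x y = (if y = z x then pmf P x else 0)" for x y
  have supp: "set_pmf P \<subseteq> strings n" using P by (simp add: dists_over_def)
  have zin: "z x \<in> strings n" for x using z S by auto
  have Q: "Q \<in> dists_over n" "set_pmf Q \<subseteq> S"
    using z(1) zin by (auto simp: Q_def dists_over_def)
  have "pmf Q y = (\<Sum>x\<in>strings n. w x y)" if "y \<in> strings n" for y
  proof -
    have "pmf Q y = measure_pmf.prob P (z -` {y})" by (simp add: Q_def pmf_map)
    \<comment> \<open>The preimage of \<open>y\<close> contains lists of every length on which
      \<open>z\<close> happens to take this value; only those of length \<open>n\<close> carry mass,
      which leaves a finite sum.\<close>
    also have "\<dots> = measure_pmf.prob P (z -` {y} \<inter> strings n)"
      using supp by (intro measure_prob_cong_0) (auto simp: set_pmf_eq)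
    also have "\<dots> = sum (pmf P) (z -` {y} \<inter> strings n)"
      by (intro measure_measure_pmf_finite) (auto simp: finite_strings)
    also have "\<dots> = (\<Sum>x\<in>strings n. if x \<in> z -` {y} then pmf P x else 0)"
      by (subst Int_commute, subst sum.inter_restrict) (auto simp: finite_strings)
    also have "\<dots> = (\<Sum>x\<in>strings n. w x y)"
      by (intro sum.cong) (auto simp: w_def)
    finally show ?thesis .
  qed
  hence w: "w \<in> couplings n P Q"
    using zin by (auto simp: couplings_def w_def finite_strings sum.delta)
  have "dist_distance n P Q \<le> (\<Sum>x\<in>strings n. \<Sum>y\<in>strings n. w x y * hamming_dist n x y)"
    unfolding dist_distance_def
  proof (rule cINF_lower[OF _ w], rule bdd_belowI[where m = 0])
    fix c assume "c \<in> (\<lambda>w. \<Sum>x\<in>strings n. \<Sum>y\<in>strings n. w x y * hamming_dist n x y) ` couplings n P Q"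
    thus "0 \<le> c"
      by (auto simp: couplings_def intro!: sum_nonneg mult_nonneg_nonneg hamming_dist_nonneg)
  qed
  also have "\<dots> = (\<Sum>x\<in>strings n. pmf P x * property_dist n S x)"
  proof (intro sum.cong refl)
    fix x
    have "(\<Sum>y\<in>strings n. w x y * hamming_dist n x y) =
        (\<Sum>y\<in>strings n. if y = z x then pmf P x * hamming_dist n x y else 0)"
      by (intro sum.cong) (auto simp: w_def)
    also have "\<dots> = pmf P x * property_dist n S x"
      using zin by (simp add: finite_strings sum.delta z(2))
    finally show "(\<Sum>y\<in>strings n. w x y * hamming_dist n x y) = pmf P x * property_dist n S x" .
  qed
  also have "\<dots> = measure_pmf.expectation P (property_dist n S)"
    using supp by (subst integral_measure_pmf[OF finite_strings[of n]]) (auto simp: mult.commute)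
  finally show ?thesis using Q by blast
qed

section \<open>Testers built from schedules\<close>

text \<open>For a string at distance \<open>d\<close> from the property, these are the entries whose
  test should reject it.\<close>

definition count_below :: "real \<Rightarrow> (real \<times> nat) list \<Rightarrow> nat" where
  "count_below d L = length (filter (\<lambda>(\<delta>, k). \<delta> < d) L)"

text \<open>Integrating the last condition over a distribution of average distance above \<open>\<epsilon>\<close> bounds the
  expected number of samples that are far at their own proximity from below by 2.\<close>
definition good_schedule :: "real \<Rightarrow> (real \<times> nat) list \<Rightarrow> bool" where
  "good_schedule \<epsilon> L \<longleftrightarrow> (\<forall>(\<delta>, k)\<in>set L. 0 < \<delta> \<and> \<delta> < 1) \<and> (\<Sum>(\<delta>, k)\<leftarrow>L. amp_rate ^ k) \<le> 1 / 3 \<and>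
     (\<exists>\<alpha>\<ge>0. \<exists>\<beta>. 2 \<le> \<alpha> * (\<epsilon> - \<beta>) \<and> (\<forall>d\<in>{0..1}. \<alpha> * (d - \<beta>) \<le> real (count_below d L)))"

lemma good_schedule_nth:
  assumes "good_schedule \<epsilon> L" "j < length L"
  shows "0 < fst (L ! j)" "fst (L ! j) < 1"
  using assms nth_mem[of j L] unfolding good_schedule_def by (force simp: case_prod_unfold)+

definition schedule_cost :: "(nat \<Rightarrow> real \<Rightarrow> nat) \<Rightarrow> nat \<Rightarrow> (real \<times> nat) list \<Rightarrow> nat" where
  "schedule_cost q n L = (\<Sum>(\<delta>, k)\<leftarrow>L. k * q n \<delta>)"

definition schedule_machine ::
    "(nat \<Rightarrow> real \<Rightarrow> nat qtree pmf) \<Rightarrow> nat \<Rightarrow> (real \<times> nat) list \<Rightarrow> (nat \<times> nat) qtree pmf" where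
  "schedule_machine T n L =
     test_samples (length L) (\<lambda>j. amplify (snd (L ! j)) (T n (fst (L ! j))))"

lemma sum_list_nth: "(\<Sum>x\<leftarrow>L. f x) = (\<Sum>j<length L. f (L ! j))"
  by (simp add: sum_list_sum_nth atLeast0LessThan)

text \<open>As a sum of indicators, the count has an expectation over a random string that splits
  into the probabilities of being far at each entry.\<close>

lemma count_below_nth:
  "real (count_below d L) = (\<Sum>j<length L. indicator {d. fst (L ! j) < d} d)"
proof -
  have "real (count_below d L) = (\<Sum>x\<leftarrow>L. indicator {d. fst x < d} d)"
    by (induction L) (auto simp: count_below_def indicator_def)
  thus ?thesis by (simp add: sum_list_nth)
qed

lemma num_queries_schedule_machine:
  assumes T: "\<And>\<delta> k t x. (\<delta>, k) \<in> set L \<Longrightarrow> t \<in> set_pmf (T n \<delta>) \<Longrightarrow> x \<in> strings n \<Longrightarrow>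
      num_queries t (bit_oracle x) \<le> q n \<delta>"
    and t: "t \<in> set_pmf (schedule_machine T n L)"
    and \<omega>: "\<omega> \<in> PiE_dflt {..<length L} [] (\<lambda>_. strings n)"
  shows "num_queries t (sample_oracle \<omega>) \<le> schedule_cost q n L"
proof -
  let ?A = "\<lambda>j. amplify (snd (L ! j)) (T n (fst (L ! j)))"
  obtain \<tau> where t: "t = all_accept (length L) \<tau>"
      and \<tau>: "\<tau> \<in> set_pmf (Pi_pmf {..<length L} (Answer False) ?A)"
    using t by (auto simp: schedule_machine_def test_samples_def)
  have "num_queries t (sample_oracle \<omega>) = (\<Sum>j<length L. num_queries (\<tau> j) (bit_oracle (\<omega> j)))"
    by (simp add: t num_queries_all_accept)
  also have "\<dots> \<le> (\<Sum>j<length L. snd (L ! j) * q n (fst (L ! j)))"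
  proof (intro sum_mono num_queries_amplify)
    fix j assume j: "j \<in> {..<length L}"
    thus "\<tau> j \<in> set_pmf (?A j)" using \<tau> by (auto simp: set_Pi_pmf PiE_dflt_def)
    fix t assume "t \<in> set_pmf (T n (fst (L ! j)))"
    thus "num_queries t (bit_oracle (\<omega> j)) \<le> q n (fst (L ! j))"
      using j \<omega> by (intro T[of _ "snd (L ! j)"]) (auto simp: PiE_dflt_def)
  qed
  also have "\<dots> = schedule_cost q n L"
    by (simp add: schedule_cost_def sum_list_nth case_prod_unfold)
  finally show ?thesis .
qed

lemma string_tester_error:
  assumes "string_tester \<Phi> q T" "n > 0" "0 < \<delta>" "\<delta> < 1"
  shows "x \<in> \<Phi> n \<Longrightarrow> measure_pmf.prob (amplify k (T n \<delta>)) {t. \<not> run t (bit_oracle x)} \<le> amp_rate ^ k"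
    and "x \<in> strings n \<Longrightarrow> finite (\<Phi> n) \<Longrightarrow> \<delta> < property_dist n (\<Phi> n) x \<Longrightarrow>
      measure_pmf.prob (amplify k (T n \<delta>)) {t. run t (bit_oracle x)} \<le> amp_rate ^ k"
proof -
  note T = assms(1)[unfolded string_tester_def, rule_format, OF assms(2), of \<delta>]
  {
    assume "x \<in> \<Phi> n"
    hence "measure_pmf.prob (T n \<delta>) {t. run t (bit_oracle x) = True} \<ge> 2 / 3"
      using T assms by auto
    from amplify_error[OF this, of k]
    show "measure_pmf.prob (amplify k (T n \<delta>)) {t. \<not> run t (bit_oracle x)} \<le> amp_rate ^ k" by simp
  }
  {
    assume "x \<in> strings n" "finite (\<Phi> n)" "\<delta> < property_dist n (\<Phi> n) x"
    hence "measure_pmf.prob (T n \<delta>) {t. run t (bit_oracle x) = False} \<ge> 2 / 3"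
      using T assms far_iff_property_dist[of "\<Phi> n" \<delta> n x] by auto
    from amplify_error[OF this, of k]
    show "measure_pmf.prob (amplify k (T n \<delta>)) {t. run t (bit_oracle x)} \<le> amp_rate ^ k" by simp
  }
qed

text \<open>Entry j wrongly rejects with probability at most \<open>e j\<close>. The Weierstrass
  product inequality plays the part of a union bound and leaves at least 1 minus the total error,
  which is at most 1/3 in a good schedule.\<close>

lemma schedule_machine_accepts:
  assumes T: "string_tester \<Phi> q T" and n: "n > 0" and L: "good_schedule \<epsilon> L"
    and P: "set_pmf P \<subseteq> \<Phi> n"
  shows "measure_pmf.prob (pair_pmf (schedule_machine T n L) (samples (length L) P))
           {(t, \<omega>). run t (sample_oracle \<omega>)} \<ge> 2 / 3"
proof -
  define e where "e j = amp_rate ^ snd (L ! j)" for j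
  have e: "e j \<in> {0..1}" for j
    using amp_rate_bounds by (auto simp: e_def power_le_one)
  have "2 / 3 \<le> 1 - (\<Sum>j<length L. e j)"
    using L by (simp add: good_schedule_def sum_list_nth e_def case_prod_unfold)
  also have "\<dots> \<le> (\<Prod>j<length L. 1 - e j)"
    by (intro Weierstrass_prod_ineq e)
  also have "\<dots> \<le> (\<Prod>j<length L. accept_prob (amplify (snd (L ! j)) (T n (fst (L ! j)))) P)"
  proof (intro prod_mono conjI)
    fix j assume "j \<in> {..<length L}"
    hence \<delta>: "0 < fst (L ! j)" "fst (L ! j) < 1"
      using good_schedule_nth[OF L] by auto
    show "1 - e j \<le> accept_prob (amplify (snd (L ! j)) (T n (fst (L ! j)))) P"
      unfolding e_def using P by (intro accept_prob_ge string_tester_error(1)[OF T n \<delta>]) auto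
    show "0 \<le> 1 - e j" using e[of j] by simp
  qed
  also have "\<dots> = measure_pmf.prob (pair_pmf (schedule_machine T n L) (samples (length L) P))
      {(t, \<omega>). run t (sample_oracle \<omega>)}"
    by (simp add: schedule_machine_def accept_prob_test_samples)
  finally show ?thesis .
qed

text \<open>Let p_j be the probability that a sample is too far for entry j. The affine lower bound
  on \<open>count_below\<close> turns the large average distance into a sum of the p_j that is at
  least 2. Each test accepts with probability at most 1 - 2/3 p_j, hence at most exp (- 2/3 p_j),
  and the product over j is at most exp (- 4/3).\<close>

lemma schedule_machine_rejects:
  assumes T: "string_tester \<Phi> q T" and n: "n > 0" and L: "good_schedule \<epsilon> L"
    and \<Phi>: "\<Phi> n \<subseteq> strings n" and P: "P \<in> dists_over n"
    and far: "\<epsilon> < measure_pmf.expectation P (property_dist n (\<Phi> n))"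
  shows "measure_pmf.prob (pair_pmf (schedule_machine T n L) (samples (length L) P))
           {(t, \<omega>). \<not> run t (sample_oracle \<omega>)} \<ge> 2 / 3"
proof -
  let ?D = "property_dist n (\<Phi> n)"
  define F where "F j = {x. fst (L ! j) < ?D x}" for j
  have fin: "finite (\<Phi> n)" using \<Phi> finite_strings finite_subset by blast
  obtain \<alpha> \<beta> where \<alpha>: "\<alpha> \<ge> 0" "2 \<le> \<alpha> * (\<epsilon> - \<beta>)"
      "\<And>d. d \<in> {0..1} \<Longrightarrow> \<alpha> * (d - \<beta>) \<le> real (count_below d L)"
    using L by (auto simp: good_schedule_def)
  \<comment> \<open>The bound on the total error also bounds each single error, so every test has
    the error 1/3 that \<open>accept_prob_le\<close> asks for.\<close>
  have err: "amp_rate ^ snd (L ! j) \<le> 1 / 3" if "j < length L" for j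
  proof -
    have "amp_rate ^ snd (L ! j) \<le> (\<Sum>j<length L. amp_rate ^ snd (L ! j))"
      using that amp_rate_bounds by (intro member_le_sum) auto
    also have "\<dots> \<le> 1 / 3" using L by (simp add: good_schedule_def sum_list_nth case_prod_unfold)
    finally show ?thesis .
  qed
  have "2 \<le> \<alpha> * (measure_pmf.expectation P ?D - \<beta>)"
    using \<alpha>(1,2) far by (smt (verit) mult_left_mono)
  also have "\<dots> = measure_pmf.expectation P (\<lambda>x. \<alpha> * (?D x - \<beta>))"
    using integrable_property_dist[OF fin] by simp
  also have "\<dots> \<le> measure_pmf.expectation P (\<lambda>x. \<Sum>j<length L. indicator (F j) x)"
  proof (intro integral_mono)
    fix x
    show "\<alpha> * (?D x - \<beta>) \<le> (\<Sum>j<length L. indicator (F j) x)"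
      using \<alpha>(3)[of "?D x"] property_dist_bounds[OF fin, of n x]
      by (auto simp: count_below_nth F_def indicator_def)
  next
    show "integrable (measure_pmf P) (\<lambda>x. \<alpha> * (?D x - \<beta>))"
      using integrable_property_dist[OF fin] by simp
    show "integrable (measure_pmf P) (\<lambda>x. \<Sum>j<length L. indicator (F j) x :: real)"
      by (intro Bochner_Integration.integrable_sum measure_pmf.integrable_const_bound[where B = 1])
         (auto simp: indicator_def)
  qed
  also have "\<dots> = (\<Sum>j<length L. measure_pmf.prob P (F j))"
    by (subst Bochner_Integration.integral_sum)
       (auto intro!: measure_pmf.integrable_const_bound[where B = 1] simp: indicator_def)
  finally have sum: "2 \<le> (\<Sum>j<length L. measure_pmf.prob P (F j))" .
  let ?A = "\<lambda>j. amplify (snd (L ! j)) (T n (fst (L ! j)))"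
  let ?M = "pair_pmf (schedule_machine T n L) (samples (length L) P)"
  have "measure_pmf.prob ?M {(t, \<omega>). run t (sample_oracle \<omega>)} = (\<Prod>j<length L. accept_prob (?A j) P)"
    by (simp add: schedule_machine_def accept_prob_test_samples)
  also have "\<dots> \<le> (\<Prod>j<length L. exp (- (2 / 3 * measure_pmf.prob P (F j))))"
  proof (intro prod_mono conjI)
    fix j assume j: "j \<in> {..<length L}"
    hence \<delta>: "0 < fst (L ! j)" "fst (L ! j) < 1"
      using good_schedule_nth[OF L] by auto
    have "accept_prob (?A j) P \<le> 1 - 2 / 3 * measure_pmf.prob P (F j)"
    proof (intro accept_prob_le)
      fix x assume "x \<in> set_pmf P" "x \<in> F j"
      hence "measure_pmf.prob (?A j) {t. run t (bit_oracle x)} \<le> amp_rate ^ snd (L ! j)"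
        using P by (intro string_tester_error(2)[OF T n \<delta>] fin) (auto simp: F_def dists_over_def)
      thus "measure_pmf.prob (?A j) {t. run t (bit_oracle x)} \<le> 1 / 3"
        using err j by fastforce
    qed
    also have "\<dots> \<le> exp (- (2 / 3 * measure_pmf.prob P (F j)))"
      using exp_ge_add_one_self[of "- (2 / 3 * measure_pmf.prob P (F j))"] by linarith
    finally show "accept_prob (?A j) P \<le> exp (- (2 / 3 * measure_pmf.prob P (F j)))" .
  qed (simp add: accept_prob_def)
  also have "\<dots> = exp (- (2 / 3 * (\<Sum>j<length L. measure_pmf.prob P (F j))))"
    by (simp add: exp_sum[symmetric] sum_distrib_left sum_negf)
  also have "\<dots> \<le> exp (- (4 / 3))" using sum by simp
  \<comment> \<open>The quadratic Taylor bound gives exp (4/3) \<ge> 1 + 4/3 + 8/9 = 29/9 > 3. This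
    is why an expected count of 2 suffices.\<close>
  also have "\<dots> \<le> 1 / 3"
    using exp_lower_Taylor_quadratic[of "4 / 3 :: real"]
    by (simp add: exp_minus power2_eq_square field_simps)
  finally have "measure_pmf.prob ?M {(t, \<omega>). run t (sample_oracle \<omega>)} \<le> 1 / 3" .
  moreover have "measure_pmf.prob ?M {(t, \<omega>). \<not> run t (sample_oracle \<omega>)} =
      1 - measure_pmf.prob ?M {(t, \<omega>). run t (sample_oracle \<omega>)}"
    by (subst measure_pmf.prob_compl[symmetric])
       (auto intro!: arg_cong[where f = "measure_pmf.prob ?M"])
  ultimately show ?thesis by linarith
qed

text \<open>What remains is to turn distance from every supported distribution into average distance
  of a sample from the property: by \<open>dist_distance_le_expectation\<close> some supported
  \<open>Q\<close> is no farther from \<open>P\<close> than this average.\<close>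

lemma schedule_machine_doho_tester:
  assumes T: "string_tester \<Phi> q T" and \<Phi>: "\<And>n. \<Phi> n \<subseteq> strings n"
    and L: "\<And>n \<epsilon>. n > 0 \<Longrightarrow> 0 < \<epsilon> \<Longrightarrow> \<epsilon> < 1 \<Longrightarrow> good_schedule \<epsilon> (L n \<epsilon>)"
  shows "doho_tester (supported_dists \<Phi>) (\<lambda>n \<epsilon>. schedule_cost q n (L n \<epsilon>))
           (\<lambda>n \<epsilon>. length (L n \<epsilon>)) (\<lambda>n \<epsilon>. schedule_machine T n (L n \<epsilon>))"
  unfolding doho_tester_def
proof (intro allI impI ballI conjI)
  fix n :: nat and \<epsilon> :: real assume n: "n > 0" and "\<epsilon> \<in> {0<..<1}"
  hence \<epsilon>: "0 < \<epsilon>" "\<epsilon> < 1" by auto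
  note good = L[OF n \<epsilon>]
  show "num_queries t (sample_oracle \<omega>) \<le> schedule_cost q n (L n \<epsilon>)"
    if "t \<in> set_pmf (schedule_machine T n (L n \<epsilon>))"
      and "\<omega> \<in> PiE_dflt {..<length (L n \<epsilon>)} [] (\<lambda>_. strings n)" for t \<omega>
    using T n good
    by (intro num_queries_schedule_machine[OF _ that])
       (auto simp: string_tester_def good_schedule_def split_beta)
  show "2 / 3 \<le> measure_pmf.prob
      (pair_pmf (schedule_machine T n (L n \<epsilon>)) (samples (length (L n \<epsilon>)) P))
      {(t, \<omega>). run t (sample_oracle \<omega>)}" if "P \<in> supported_dists \<Phi> n" for P
    using that by (intro schedule_machine_accepts[OF T n good]) (auto simp: supported_dists_def)
  show "2 / 3 \<le> measure_pmf.prob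
      (pair_pmf (schedule_machine T n (L n \<epsilon>)) (samples (length (L n \<epsilon>)) P))
      {(t, \<omega>). \<not> run t (sample_oracle \<omega>)}"
    if P: "P \<in> dists_over n" and far: "\<forall>Q\<in>supported_dists \<Phi> n. dist_distance n P Q > \<epsilon>" for P
  proof (rule schedule_machine_rejects[OF T n good \<Phi> P])
    show "\<epsilon> < measure_pmf.expectation P (property_dist n (\<Phi> n))"
    \<comment> \<open>For an empty property there is no \<open>Q\<close> to compare with; then the
      default value 1 of \<open>property_dist\<close> exceeds \<open>\<epsilon>\<close>.\<close>
    proof (cases "\<Phi> n = {}")
      case True
      thus ?thesis using \<epsilon> by (simp add: property_dist_def[abs_def])
    next
      case False
      from dist_distance_le_expectation[OF \<Phi> this P] far show ?thesis
        by (force simp: supported_dists_def)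
    qed
  qed
qed

section \<open>The flat schedule and the bound for arbitrary \<open>q\<close>\<close>

text \<open>To be used with \<open>x = 1 / \<epsilon>\<close>: a flat schedule has at most
  \<open>5 * x\<close> entries, so errors of at most 1 / (15 x) add up to at most 1/3. Since
  \<open>ln 15\<close> is at least 1, ln (15 x) \<le> ln 15 (1 + ln x), and dividing by - ln
  \<open>amp_rate\<close> yields the exponent.\<close>

lemma ex_amp_exponent:
  "\<exists>c>0. \<forall>x\<ge>1. 15 * x * amp_rate ^ nat \<lceil>c * (1 + ln x)\<rceil> \<le> 1"
proof -
  define l where "l = - ln amp_rate"
  have l: "l > 0" using amp_rate_bounds by (simp add: l_def)
  have ln15: "ln 15 \<ge> (1 :: real)"
    using exp_le by (subst ln_ge_iff) auto
  show ?thesis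
  proof (intro exI[of _ "ln 15 / l"] conjI allI impI)
    show "ln 15 / l > 0" using l by simp
    fix x :: real assume x: "x \<ge> 1"
    define k where "k = nat \<lceil>ln 15 / l * (1 + ln x)\<rceil>"
    have "ln (15 * x) = ln 15 + ln x" using x by (simp add: ln_mult)
    also have "\<dots> \<le> ln 15 * (1 + ln x)"
      using ln15 x mult_right_mono[of 1 "ln 15" "ln x"]
      by (simp add: algebra_simps)
    also have "\<dots> = l * (ln 15 / l * (1 + ln x))" using l by simp
    also have "\<dots> \<le> l * real k"
      using l unfolding k_def by (intro mult_left_mono) (auto intro: real_nat_ceiling_ge)
    also have "\<dots> = - ln (amp_rate ^ k)" using amp_rate_bounds by (simp add: ln_realpow l_def)
    finally have "ln (15 * x * amp_rate ^ k) \<le> 0"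
      using x amp_rate_bounds by (simp add: ln_mult)
    thus "15 * x * amp_rate ^ nat \<lceil>ln 15 / l * (1 + ln x)\<rceil> \<le> 1"
      using x amp_rate_bounds unfolding k_def by (subst (asm) ln_le_zero_iff) auto
  qed
qed

definition flat_schedule :: "real \<Rightarrow> real \<Rightarrow> (real \<times> nat) list" where
  "flat_schedule c \<epsilon> = replicate (nat \<lceil>4 / \<epsilon>\<rceil>) (\<epsilon> / 2, nat \<lceil>c * (1 + ln (1 / \<epsilon>))\<rceil>)"

lemma length_flat_schedule:
  assumes "0 < \<epsilon>" "\<epsilon> < 1"
  shows "real (length (flat_schedule c \<epsilon>)) \<le> 5 / \<epsilon>"
proof -
  have "real (nat \<lceil>4 / \<epsilon>\<rceil>) \<le> 4 / \<epsilon> + 1" using assms by (simp add: of_nat_nat)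
  also have "\<dots> \<le> 5 / \<epsilon>" using assms by (simp add: field_simps)
  finally show ?thesis by (simp add: flat_schedule_def)
qed

text \<open>The affine function with slope \<open>4 / \<epsilon>\<close> and zero at the common
  proximity \<open>\<epsilon> / 2\<close> equals 2 at \<open>\<epsilon>\<close>. On [0,1] it never
  exceeds its slope, which is at most the number of entries, and it is not positive where the count
  vanishes.\<close>

lemma good_flat_schedule:
  assumes \<epsilon>: "0 < \<epsilon>" "\<epsilon> < 1"
    and c: "\<forall>x\<ge>1. 15 * x * amp_rate ^ nat \<lceil>c * (1 + ln x)\<rceil> \<le> 1"
  shows "good_schedule \<epsilon> (flat_schedule c \<epsilon>)"
proof -
  let ?k = "nat \<lceil>c * (1 + ln (1 / \<epsilon>))\<rceil>"
  have "(\<Sum>(\<delta>, k)\<leftarrow>flat_schedule c \<epsilon>. amp_rate ^ k) =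
      real (length (flat_schedule c \<epsilon>)) * amp_rate ^ ?k"
    by (simp add: flat_schedule_def sum_list_replicate)
  also have "\<dots> \<le> 5 / \<epsilon> * amp_rate ^ ?k"
    using length_flat_schedule[OF \<epsilon>, of c] amp_rate_bounds by (intro mult_right_mono) auto
  also have "\<dots> \<le> 1 / 3" using c[rule_format, of "1 / \<epsilon>"] \<epsilon> by (simp add: field_simps)
  finally have err: "(\<Sum>(\<delta>, k)\<leftarrow>flat_schedule c \<epsilon>. amp_rate ^ k) \<le> 1 / 3" .
  have "4 / \<epsilon> * (d - \<epsilon> / 2) \<le> real (count_below d (flat_schedule c \<epsilon>))" if "d \<in> {0..1}" for d
  proof (cases "\<epsilon> / 2 < d")
    case True
    have "4 / \<epsilon> * (d - \<epsilon> / 2) \<le> 4 / \<epsilon> * 1" using \<epsilon> that by (intro mult_left_mono) auto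
    also have "\<dots> \<le> real (nat \<lceil>4 / \<epsilon>\<rceil>)" by (simp add: real_nat_ceiling_ge)
    finally show ?thesis using True by (simp add: count_below_def flat_schedule_def)
  next
    case False
    hence "4 / \<epsilon> * (d - \<epsilon> / 2) \<le> 0" using \<epsilon> by (intro mult_nonneg_nonpos) auto
    also have "0 \<le> real (count_below d (flat_schedule c \<epsilon>))" by simp
    finally show ?thesis .
  qed
  moreover have "2 \<le> 4 / \<epsilon> * (\<epsilon> - \<epsilon> / 2)" using \<epsilon> by (simp add: field_simps)
  moreover have "4 / \<epsilon> \<ge> 0" using \<epsilon> by simp
  moreover have "\<forall>(\<delta>, k)\<in>set (flat_schedule c \<epsilon>). 0 < \<delta> \<and> \<delta> < 1"
    using \<epsilon> by (auto simp: flat_schedule_def)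
  ultimately show ?thesis
    using err unfolding good_schedule_def by blast
qed

text \<open>The exponent 1 is kept in order to match the pattern with an unspecified power of the
  logarithm by which the soft-O is expressed.\<close>

lemma flat_schedule_cost:
  assumes \<epsilon>: "0 < \<epsilon>" "\<epsilon> < 1" and c: "c > 0"
  shows "real (schedule_cost q n (flat_schedule c \<epsilon>)) \<le>
           5 * (c + 1) * (1 / \<epsilon> * (1 + ln (1 / \<epsilon>)) ^ 1 * real (q n (\<epsilon> / 2)))"
proof -
  let ?k = "nat \<lceil>c * (1 + ln (1 / \<epsilon>))\<rceil>"
  have ln: "ln (1 / \<epsilon>) \<ge> 0" using \<epsilon> by simp
  have "c * (1 + ln (1 / \<epsilon>)) \<ge> 0" using c ln by simp
  hence "real ?k \<le> c * (1 + ln (1 / \<epsilon>)) + 1" by linarith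
  also have "\<dots> \<le> (c + 1) * (1 + ln (1 / \<epsilon>))" using ln by (simp add: algebra_simps)
  finally have k: "real ?k \<le> (c + 1) * (1 + ln (1 / \<epsilon>))" .
  have "real (schedule_cost q n (flat_schedule c \<epsilon>)) =
      real (length (flat_schedule c \<epsilon>)) * real ?k * real (q n (\<epsilon> / 2))"
    by (simp add: schedule_cost_def flat_schedule_def sum_list_replicate)
  also have "\<dots> \<le> 5 / \<epsilon> * ((c + 1) * (1 + ln (1 / \<epsilon>))) * real (q n (\<epsilon> / 2))"
    using \<epsilon> by (intro mult_right_mono mult_mono k length_flat_schedule) auto
  also have "\<dots> = 5 * (c + 1) * (1 / \<epsilon> * (1 + ln (1 / \<epsilon>)) ^ 1 * real (q n (\<epsilon> / 2)))"
    by simp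
  finally show ?thesis .
qed

section \<open>The doubling schedule\<close>

text \<open>For \<open>0 < \<epsilon>\<close> and \<open>\<epsilon> \<le> b\<close> this is the last
  number of doublings that keeps the proximity at most \<open>b\<close>.\<close>

definition level :: "real \<Rightarrow> real \<Rightarrow> nat" where
  "level b \<epsilon> = nat \<lfloor>log 2 (b / \<epsilon>)\<rfloor>"

lemma level_bounds:
  assumes "0 < \<epsilon>" "\<epsilon> \<le> b"
  shows "2 ^ level b \<epsilon> * \<epsilon> \<le> b" "b < 2 * 2 ^ level b \<epsilon> * \<epsilon>"
proof -
  let ?l = "log 2 (b / \<epsilon>)"
  have l: "?l \<ge> 0" using assms by simp
  have b: "2 powr ?l * \<epsilon> = b" using assms by simp
  have "2 powr real (level b \<epsilon>) \<le> 2 powr ?l"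
    using l by (intro powr_mono) (auto simp: level_def of_nat_nat)
  hence "2 powr real (level b \<epsilon>) * \<epsilon> \<le> 2 powr ?l * \<epsilon>"
    using assms by (intro mult_right_mono) auto
  thus "2 ^ level b \<epsilon> * \<epsilon> \<le> b" unfolding b by (simp add: powr_realpow)
  have "?l < real (level b \<epsilon>) + 1" using l by (simp add: level_def of_nat_nat)
  hence "2 powr ?l < 2 powr (real (level b \<epsilon>) + 1)" by (intro powr_less_mono) auto
  hence "2 powr ?l * \<epsilon> < 2 powr (real (level b \<epsilon>) + 1) * \<epsilon>"
    using assms by (intro mult_strict_right_mono) auto
  thus "b < 2 * 2 ^ level b \<epsilon> * \<epsilon>" unfolding b by (simp add: powr_add powr_realpow mult.commute)
qed

text \<open>The number of runs grows linearly in the level, so the error of a single test decays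
  geometrically and outweighs the \<open>2 ^ i\<close> copies; no factor ln (1 /
  \<open>\<epsilon>\<close>) is spent on the small proximities. The block at
  \<open>\<rho> * \<epsilon>\<close> catches strings with distance between
  \<open>\<rho> * \<epsilon>\<close> and \<open>\<epsilon>\<close>.\<close>

definition doubling_schedule :: "real \<Rightarrow> nat \<Rightarrow> nat \<Rightarrow> nat \<Rightarrow> real \<Rightarrow> (real \<times> nat) list" where
  "doubling_schedule \<rho> C k0 l \<epsilon> = replicate C (\<rho> * \<epsilon>, k0) @
     concat (map (\<lambda>i. replicate (C * 2 ^ i) (2 ^ i * \<epsilon>, k0 * (i + 1))) [0..<Suc l])"

text \<open>Length, error, cost and \<open>count_below\<close> are all sums over the entries and are
  evaluated by this formula.\<close>

lemma sum_list_doubling_schedule: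
  fixes f :: "real \<times> nat \<Rightarrow> real"
  shows "(\<Sum>x\<leftarrow>doubling_schedule \<rho> C k0 l \<epsilon>. f x) =
    real C * f (\<rho> * \<epsilon>, k0) + (\<Sum>i\<le>l. real C * 2 ^ i * f (2 ^ i * \<epsilon>, k0 * (i + 1)))"
proof -
  have "(\<Sum>x\<leftarrow>concat (map (\<lambda>i. replicate (C * 2 ^ i) (2 ^ i * \<epsilon>, k0 * (i + 1))) xs). f x) =
      (\<Sum>i\<leftarrow>xs. real C * 2 ^ i * f (2 ^ i * \<epsilon>, k0 * (i + 1)))" for xs
    by (induction xs) (auto simp: sum_list_replicate)
  thus ?thesis
    by (simp only: doubling_schedule_def map_append sum_list_append interv_sum_list_conv_sum_set_nat
          set_upt atLeast0LessThan lessThan_Suc_atMost map_replicate sum_list_replicate)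
qed

lemma length_doubling_schedule:
  "real (length (doubling_schedule \<rho> C k0 l \<epsilon>)) = real C * (2 * 2 ^ l)"
proof -
  have "real (length L) = (\<Sum>x\<leftarrow>L. 1)" for L :: "(real \<times> nat) list"
    by (induction L) auto
  hence "real (length (doubling_schedule \<rho> C k0 l \<epsilon>)) = real C * (1 + (\<Sum>i\<le>l. 2 ^ i))"
    by (simp only: sum_list_doubling_schedule) (simp add: sum_distrib_left algebra_simps)
  also have "(\<Sum>i\<le>l. 2 ^ i) = (2 * 2 ^ l - 1 :: real)" by (induction l) auto
  finally show ?thesis by simp
qed

lemma count_below_sum_list: "real (count_below d L) = (\<Sum>x\<leftarrow>L. if fst x < d then 1 else 0)"
  by (induction L) (auto simp: count_below_def)

text \<open>With r = \<open>amp_rate ^ k0\<close>, level i contributes C r (2 r)^i, and both r and C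
  r are at most 1/8. The levels thus add up to at most 1/6, the first block adds at most 1/8, and
  the total is at most 7/24.\<close>

lemma doubling_schedule_error:
  assumes "C \<ge> 1" "8 * real C * amp_rate ^ k0 \<le> 1"
  shows "(\<Sum>(\<delta>, k)\<leftarrow>doubling_schedule \<rho> C k0 l \<epsilon>. amp_rate ^ k) \<le> 1 / 3"
proof -
  define r where "r = amp_rate ^ k0"
  have r: "0 \<le> r" "real C * r \<le> 1 / 8" "r \<le> 1 / 8"
  proof -
    show "0 \<le> r" using amp_rate_bounds by (simp add: r_def)
    show "real C * r \<le> 1 / 8" using assms by (simp add: r_def)
    moreover have "1 * r \<le> real C * r" using assms \<open>0 \<le> r\<close> by (intro mult_right_mono) auto
    ultimately show "r \<le> 1 / 8" by simp
  qed
  have "(\<Sum>(\<delta>, k)\<leftarrow>doubling_schedule \<rho> C k0 l \<epsilon>. amp_rate ^ k) =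
      real C * r + (\<Sum>i\<le>l. real C * 2 ^ i * r ^ (i + 1))"
    by (simp only: sum_list_doubling_schedule case_prod_unfold snd_conv r_def power_mult)
  also have "(\<Sum>i\<le>l. real C * 2 ^ i * r ^ (i + 1)) = (\<Sum>i\<le>l. real C * r * (2 * r) ^ i)"
    by (simp add: power_mult_distrib mult_ac)
  also have "\<dots> \<le> (\<Sum>i\<le>l. 1 / 8 * (1 / 4) ^ i)"
    using r by (intro sum_mono mult_mono power_mono) auto
  also have "\<dots> \<le> 1 / 6"
  proof -
    have "(\<Sum>i\<le>l. 1 / 8 * (1 / 4) ^ i) = 1 / 6 - 1 / 24 * (1 / 4 :: real) ^ l"
      by (induction l) auto
    thus ?thesis by simp
  qed
  finally show ?thesis using r(2) by simp
qed

text \<open>The affine function that vanishes at \<open>\<rho> * \<epsilon>\<close> and equals 2 at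
  \<open>\<epsilon>\<close> stays below the count in three ranges: up to
  \<open>\<rho> * \<epsilon>\<close> it is not positive; from there to \<open>\<epsilon>\<close> it
  is at most 2, which the first block covers; beyond \<open>\<epsilon>\<close> the entries of the
  highest level whose proximity is still below \<open>d\<close> suffice alone.\<close>

lemma good_doubling_schedule:
  assumes \<epsilon>: "0 < \<epsilon>" "\<epsilon> \<le> b" and b: "b < 1" and \<rho>: "0 < \<rho>" "\<rho> < 1"
    and C: "4 / ((1 - \<rho>) * b) \<le> real C" and k0: "8 * real C * amp_rate ^ k0 \<le> 1"
  shows "good_schedule \<epsilon> (doubling_schedule \<rho> C k0 (level b \<epsilon>) \<epsilon>)"
proof -
  let ?l = "level b \<epsilon>"
  let ?L = "doubling_schedule \<rho> C k0 ?l \<epsilon>"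
  note level = level_bounds[OF \<epsilon>]
  have b0: "b > 0" using \<epsilon> by simp
  have Cpos: "real C > 0" using C \<rho> b0 by (smt (verit) divide_pos_pos mult_pos_pos)
  have small: "2 ^ i * \<epsilon> < 1" if "i \<le> ?l" for i
  proof -
    have "2 ^ i * \<epsilon> \<le> 2 ^ ?l * \<epsilon>" using that \<epsilon> by (intro mult_right_mono power_increasing) auto
    thus ?thesis using level b by linarith
  qed
  have \<rho>\<epsilon>: "0 < \<rho> * \<epsilon>" "\<rho> * \<epsilon> < \<epsilon>" using \<rho> \<epsilon> by auto
  have rng: "\<forall>(\<delta>, k)\<in>set ?L. 0 < \<delta> \<and> \<delta> < 1"
    using small \<epsilon> b \<rho>\<epsilon> by (auto simp: doubling_schedule_def simp del: upt_Suc)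
  define \<alpha> where "\<alpha> = 2 / ((1 - \<rho>) * \<epsilon>)"
  have \<alpha>: "\<alpha> \<ge> 0" "\<alpha> * (\<epsilon> - \<rho> * \<epsilon>) = 2"
  proof -
    show "\<alpha> \<ge> 0" using \<rho> \<epsilon> by (simp add: \<alpha>_def)
    have "\<epsilon> - \<rho> * \<epsilon> = (1 - \<rho>) * \<epsilon>" by (simp add: algebra_simps)
    thus "\<alpha> * (\<epsilon> - \<rho> * \<epsilon>) = 2" using \<rho> \<epsilon> by (simp add: \<alpha>_def)
  qed
  have C2: "real C \<ge> 2"
  proof -
    have "(1 - \<rho>) * b \<le> 1 * 1" using \<rho> b b0 by (intro mult_mono) auto
    hence "4 \<le> 4 / ((1 - \<rho>) * b)" using \<rho> b0 by (simp add: field_simps)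
    thus ?thesis using C by linarith
  qed
  have "\<alpha> * (d - \<rho> * \<epsilon>) \<le> real (count_below d ?L)" if d: "d \<in> {0..1}" for d
  proof -
    define g where "g i = real C * 2 ^ i * (if 2 ^ i * \<epsilon> < d then 1 else 0)" for i
    have g: "g i \<ge> 0" for i by (simp add: g_def)
    have cnt: "real (count_below d ?L) = real C * (if \<rho> * \<epsilon> < d then 1 else 0) + (\<Sum>i\<le>?l. g i)"
      unfolding count_below_sum_list sum_list_doubling_schedule g_def by simp
    consider "d \<le> \<rho> * \<epsilon>" | "\<rho> * \<epsilon> < d" "d \<le> \<epsilon>" | "\<epsilon> < d" by linarith
    thus ?thesis
    proof cases
      case 1
      hence "\<alpha> * (d - \<rho> * \<epsilon>) \<le> 0" using \<alpha> by (intro mult_nonneg_nonpos) auto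
      thus ?thesis by linarith
    next
      case 2
      have "\<alpha> * (d - \<rho> * \<epsilon>) \<le> \<alpha> * (\<epsilon> - \<rho> * \<epsilon>)" using \<alpha>(1) 2 by (intro mult_left_mono) auto
      also have "\<dots> \<le> real C" using \<alpha> C2 by simp
      also have "\<dots> \<le> real (count_below d ?L)"
        unfolding cnt using 2 sum_nonneg[of "{..?l}" g] g by simp
      finally show ?thesis .
    next
      case 3
      define I where "I = {i. i \<le> ?l \<and> 2 ^ i * \<epsilon> < d}"
      have I: "finite I" "I \<noteq> {}" using 3 by (auto simp: I_def intro!: exI[of _ 0])
      define i where "i = Max I"
      have "i \<in> I" using Max_in[OF I] by (simp add: i_def)
      hence i: "i \<le> ?l" "2 ^ i * \<epsilon> < d" by (auto simp: I_def)
      \<comment> \<open>Below the top level the next proximity is at least \<open>d\<close>. At the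
        top there is no next level, only \<open>d \<le> 1\<close> and the fact that another doubling
        would exceed \<open>b\<close>; the factor \<open>b\<close> accounts for that case.\<close>
      have d_le: "d * b \<le> 2 * 2 ^ i * \<epsilon>"
      proof (cases "i = ?l")
        case True
        have "d * b \<le> 1 * b" using d b0 by (intro mult_right_mono) auto
        thus ?thesis using level(2) True by simp
      next
        case False
        have "Suc i \<notin> I" using Max_ge[OF I(1), of "Suc i"] by (auto simp: i_def)
        hence "d \<le> 2 * 2 ^ i * \<epsilon>" using i False by (auto simp: I_def)
        moreover have "d * b \<le> d * 1" using d b b0 by (intro mult_left_mono) auto
        ultimately show ?thesis by simp
      qed
      have "\<alpha> * (d - \<rho> * \<epsilon>) \<le> \<alpha> * d" using \<alpha>(1) \<rho>\<epsilon> by (intro mult_left_mono) auto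
      also have "\<dots> = 2 / ((1 - \<rho>) * b * \<epsilon>) * (d * b)" using b0 by (simp add: \<alpha>_def)
      also have "\<dots> \<le> 2 / ((1 - \<rho>) * b * \<epsilon>) * (2 * 2 ^ i * \<epsilon>)"
        using d_le \<rho> b0 \<epsilon> by (intro mult_left_mono) auto
      \<comment> \<open>The lower bound required of \<open>C\<close> originates here.\<close>
      also have "\<dots> = 4 / ((1 - \<rho>) * b) * 2 ^ i" using \<epsilon> by simp
      also have "\<dots> \<le> real C * 2 ^ i" using C by (intro mult_right_mono) auto
      also have "\<dots> = g i" using i by (simp add: g_def)
      also have "\<dots> \<le> (\<Sum>i\<le>?l. g i)" using i g by (intro member_le_sum) auto
      also have "\<dots> \<le> real (count_below d ?L)" unfolding cnt by simp
      finally show ?thesis .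
    qed
  qed
  moreover have "2 \<le> \<alpha> * (\<epsilon> - \<rho> * \<epsilon>)" using \<alpha> by simp
  moreover have "(\<Sum>(\<delta>, k)\<leftarrow>?L. amp_rate ^ k) \<le> 1 / 3"
    using Cpos k0 by (intro doubling_schedule_error) auto
  ultimately show ?thesis
    using rng \<alpha>(1) unfolding good_schedule_def by blast
qed

text \<open>Each doubling of the proximity multiplies \<open>q\<close> by at most
  \<open>s / 2\<close> while the number of samples doubles, so level i costs a factor
  \<open>s ^ i\<close>, times \<open>i + 1\<close> for the runs. The summand 1 stands for the block
  at \<open>\<rho> * \<epsilon>\<close>, the reason for \<open>q_near\<close> in place of
  \<open>q\<close>.\<close>

lemma doubling_schedule_cost:
  assumes q: "\<And>i. i \<le> l \<Longrightarrow> real (q n (2 ^ i * \<epsilon>)) \<le> (s / 2) ^ i * real (q n \<epsilon>)" and s: "s > 0"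
  shows "real (schedule_cost q n (doubling_schedule \<rho> C k0 l \<epsilon>)) \<le>
    real (C * k0) * ((1 + (\<Sum>i\<le>l. real (i + 1) * s ^ i)) * q_near q \<rho> n \<epsilon>)"
proof -
  let ?N = "q_near q \<rho> n \<epsilon>"
  have "real (schedule_cost q n L) = (\<Sum>x\<leftarrow>L. real (snd x) * real (q n (fst x)))" for L
    by (induction L) (auto simp: schedule_cost_def)
  hence "real (schedule_cost q n (doubling_schedule \<rho> C k0 l \<epsilon>)) =
      real C * (real k0 * real (q n (\<rho> * \<epsilon>))) +
      (\<Sum>i\<le>l. real C * 2 ^ i * (real (k0 * (i + 1)) * real (q n (2 ^ i * \<epsilon>))))"
    by (simp only: sum_list_doubling_schedule fst_conv snd_conv)
  also have "\<dots> \<le> real C * (real k0 * ?N) + (\<Sum>i\<le>l. real (C * k0) * (real (i + 1) * s ^ i) * ?N)"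
  proof (intro add_mono sum_mono)
    show "real C * (real k0 * real (q n (\<rho> * \<epsilon>))) \<le> real C * (real k0 * ?N)"
      by (intro mult_left_mono) (auto simp: q_near_def)
    fix i assume "i \<in> {..l}"
    hence "real (q n (2 ^ i * \<epsilon>)) \<le> (s / 2) ^ i * real (q n \<epsilon>)" using q by simp
    also have "\<dots> \<le> (s / 2) ^ i * ?N" using s by (intro mult_left_mono) (auto simp: q_near_def)
    finally have "real (C * k0) * real (i + 1) * 2 ^ i * real (q n (2 ^ i * \<epsilon>)) \<le>
        real (C * k0) * real (i + 1) * 2 ^ i * ((s / 2) ^ i * ?N)"
      by (intro mult_left_mono) auto
    also have "\<dots> = real (C * k0) * (real (i + 1) * s ^ i) * ?N"
      by (simp add: power_divide)
    finally show "real C * 2 ^ i * (real (k0 * (i + 1)) * real (q n (2 ^ i * \<epsilon>))) \<le>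
        real (C * k0) * (real (i + 1) * s ^ i) * ?N"
      by (simp only: of_nat_mult mult_ac)
  qed
  also have "\<dots> = real (C * k0) * ((1 + (\<Sum>i\<le>l. real (i + 1) * s ^ i)) * ?N)"
    by (simp add: sum_distrib_left sum_distrib_right algebra_simps)
  finally show ?thesis .
qed

section \<open>From schedules to complexity bounds\<close>

lemma doho_testable_mono:
  assumes "doho_testable \<D> R B"
    and B: "\<And>n \<epsilon>. (n, \<epsilon>) \<in> R \<Longrightarrow> 0 \<le> B n \<epsilon> \<and> B n \<epsilon> \<le> M * B' n \<epsilon>"
    and B': "\<And>n \<epsilon>. (n, \<epsilon>) \<in> R \<Longrightarrow> 0 \<le> B' n \<epsilon>"
  shows "doho_testable \<D> R B'"
proof -
  obtain q' s T K where T: "doho_tester \<D> q' s T"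
    and q': "\<forall>(n, \<epsilon>)\<in>R. real (q' n \<epsilon>) \<le> K * B n \<epsilon>"
    and s: "\<forall>n>0. \<forall>\<epsilon>\<in>{0<..<1}. real (s n \<epsilon>) \<le> K / \<epsilon>"
    using assms(1) unfolding doho_testable_def by blast
  \<comment> \<open>One constant serves for queries and samples, and its sign is unknown: the first
    argument of the maximum covers the queries, the second the samples.\<close>
  define K' where "K' = max (\<bar>K\<bar> * M) K"
  have "real (q' n \<epsilon>) \<le> K' * B' n \<epsilon>" if R: "(n, \<epsilon>) \<in> R" for n \<epsilon>
  proof -
    have "real (q' n \<epsilon>) \<le> K * B n \<epsilon>" using q' R by auto
    also have "\<dots> \<le> \<bar>K\<bar> * B n \<epsilon>" using B[OF R] by (intro mult_right_mono) auto
    also have "\<dots> \<le> \<bar>K\<bar> * (M * B' n \<epsilon>)" using B[OF R] by (intro mult_left_mono) auto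
    also have "\<dots> \<le> K' * B' n \<epsilon>"
      unfolding mult.assoc[symmetric] using B'[OF R] by (intro mult_right_mono) (auto simp: K'_def)
    finally show ?thesis .
  qed
  moreover have "real (s n \<epsilon>) \<le> K' / \<epsilon>" if "n > 0" "\<epsilon> \<in> {0<..<1}" for n \<epsilon>
  proof -
    have "real (s n \<epsilon>) \<le> K / \<epsilon>" using s that by blast
    also have "\<dots> \<le> K' / \<epsilon>" using that by (intro divide_right_mono) (auto simp: K'_def)
    finally show ?thesis .
  qed
  ultimately show ?thesis using T unfolding doho_testable_def by blast
qed

lemma doho_testable_flat:
  assumes T: "string_tester \<Phi> q T" and \<Phi>: "\<And>n. \<Phi> n \<subseteq> strings n"
  shows "doho_testable (supported_dists \<Phi>) {(n, \<epsilon>). n > 0 \<and> 0 < \<epsilon> \<and> \<epsilon> < 1}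
           (\<lambda>n \<epsilon>. 1 / \<epsilon> * (1 + ln (1 / \<epsilon>)) ^ 1 * real (q n (\<epsilon> / 2)))"
proof -
  obtain c where c: "c > 0" "\<forall>x\<ge>1. 15 * x * amp_rate ^ nat \<lceil>c * (1 + ln x)\<rceil> \<le> 1"
    using ex_amp_exponent by blast
  show ?thesis
    unfolding doho_testable_def
  proof (intro exI conjI ballI allI impI)
    show "doho_tester (supported_dists \<Phi>) (\<lambda>n \<epsilon>. schedule_cost q n (flat_schedule c \<epsilon>))
        (\<lambda>n \<epsilon>. length (flat_schedule c \<epsilon>)) (\<lambda>n \<epsilon>. schedule_machine T n (flat_schedule c \<epsilon>))"
      using c by (intro schedule_machine_doho_tester[OF T \<Phi>] good_flat_schedule) auto
    show "case x of (n, \<epsilon>) \<Rightarrow> real (schedule_cost q n (flat_schedule c \<epsilon>)) \<le>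
        5 * (c + 1) * (1 / \<epsilon> * (1 + ln (1 / \<epsilon>)) ^ 1 * real (q n (\<epsilon> / 2)))"
      if "x \<in> {(n, \<epsilon>). n > 0 \<and> 0 < \<epsilon> \<and> \<epsilon> < 1}" for x
      using that flat_schedule_cost[OF _ _ c(1)] by auto
    show "real (length (flat_schedule c \<epsilon>)) \<le> 5 * (c + 1) / \<epsilon>" if "\<epsilon> \<in> {0<..<1}" for \<epsilon>
    proof -
      have "real (length (flat_schedule c \<epsilon>)) \<le> 5 / \<epsilon>" using that by (intro length_flat_schedule) auto
      also have "\<dots> \<le> 5 * (c + 1) / \<epsilon>" using that c by (intro divide_right_mono) auto
      finally show ?thesis .
    qed
  qed
qed

lemma doho_testable_doubling:
  assumes T: "string_tester \<Phi> q T" and \<Phi>: "\<And>n. \<Phi> n \<subseteq> strings n"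
    and a: "0 < a" and b: "0 < b" "b < 1" and \<rho>: "0 < \<rho>" "\<rho> < 1" and s: "s > 0"
    and growth: "\<And>n \<epsilon>. (n, \<epsilon>) \<in> eps_range a b \<Longrightarrow> real (q n (2 * \<epsilon>)) \<le> s / 2 * real (q n \<epsilon>)"
  shows "doho_testable (supported_dists \<Phi>) (eps_range a b)
           (\<lambda>n \<epsilon>. (1 + (\<Sum>i\<le>level b \<epsilon>. real (i + 1) * s ^ i)) * q_near q \<rho> n \<epsilon>)"
proof -
  obtain c where c: "c > 0" "\<forall>x\<ge>1. 15 * x * amp_rate ^ nat \<lceil>c * (1 + ln x)\<rceil> \<le> 1"
    using ex_amp_exponent by blast
  define C where "C = nat \<lceil>4 / ((1 - \<rho>) * b)\<rceil>"
  have C: "4 / ((1 - \<rho>) * b) \<le> real C" unfolding C_def by (rule real_nat_ceiling_ge)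
  have "4 / ((1 - \<rho>) * b) > 0" using \<rho> b by simp
  hence Cpos: "real C > 0" using C by linarith
  \<comment> \<open>\<open>C\<close> depends on \<open>\<rho>\<close> and \<open>b\<close> only, and
    \<open>k0\<close> on \<open>C\<close> only, so the implied constant is independent of
    \<open>n\<close> and \<open>\<epsilon>\<close>.\<close>
  obtain k0 where "amp_rate ^ k0 < 1 / (8 * real C)"
    using real_arch_pow_inv[of "1 / (8 * real C)" amp_rate] Cpos amp_rate_bounds by auto
  hence k0: "8 * real C * amp_rate ^ k0 \<le> 1" using Cpos by (simp add: field_simps)
  \<comment> \<open>Correctness and the sample bound are demanded for all \<open>n > 0\<close> and
    all \<open>\<epsilon>\<close> in (0,1), the query bound only on \<open>eps_range a b\<close>;
    outside that range the flat schedule takes over.\<close>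
  define L where "L n \<epsilon> = (if (n, \<epsilon>) \<in> eps_range a b
      then doubling_schedule \<rho> C k0 (level b \<epsilon>) \<epsilon> else flat_schedule c \<epsilon>)" for n \<epsilon>
  define K where "K = max (real (C * k0)) (max 5 (2 * real C))"
  have pos: "0 < \<epsilon>" "\<epsilon> \<le> b" if "(n, \<epsilon>) \<in> eps_range a b" for n \<epsilon>
  proof -
    have "0 < a / real n" "a / real n \<le> \<epsilon>" using that a by (auto simp: eps_range_def)
    thus "0 < \<epsilon>" by linarith
    show "\<epsilon> \<le> b" using that by (auto simp: eps_range_def)
  qed
  show ?thesis
    unfolding doho_testable_def
  proof (intro exI conjI ballI allI impI)
    show "doho_tester (supported_dists \<Phi>) (\<lambda>n \<epsilon>. schedule_cost q n (L n \<epsilon>))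
        (\<lambda>n \<epsilon>. length (L n \<epsilon>)) (\<lambda>n \<epsilon>. schedule_machine T n (L n \<epsilon>))"
    proof (intro schedule_machine_doho_tester[OF T \<Phi>])
      fix n :: nat and \<epsilon> :: real assume "0 < \<epsilon>" "\<epsilon> < 1"
      thus "good_schedule \<epsilon> (L n \<epsilon>)"
        using good_flat_schedule[OF _ _ c(2)] good_doubling_schedule[OF pos b(2) \<rho> C k0]
        by (auto simp: L_def)
    qed
    show "case x of (n, \<epsilon>) \<Rightarrow> real (schedule_cost q n (L n \<epsilon>)) \<le>
        K * ((1 + (\<Sum>i\<le>level b \<epsilon>. real (i + 1) * s ^ i)) * q_near q \<rho> n \<epsilon>)"
      if "x \<in> eps_range a b" for x
    proof -
      obtain n \<epsilon> where x: "x = (n, \<epsilon>)" by (cases x)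
      with that have R: "(n, \<epsilon>) \<in> eps_range a b" by simp
      note \<epsilon> = pos[OF R]
      \<comment> \<open>The growth condition is iterated. It applies at each
        \<open>2 ^ i * \<epsilon>\<close> with \<open>i\<close> below the level, as doubling
        preserves the lower end of the range and \<open>level_bounds\<close> guards the upper
        one.\<close>
      have bound: "real (q n (2 ^ i * \<epsilon>)) \<le> (s / 2) ^ i * real (q n \<epsilon>)" if "i \<le> level b \<epsilon>" for i
        using that
      proof (induction i)
        case (Suc i)
        have "1 * \<epsilon> \<le> 2 ^ i * \<epsilon>" using \<epsilon> by (intro mult_right_mono) auto
        moreover have "2 ^ i * \<epsilon> \<le> 2 ^ level b \<epsilon> * \<epsilon>"
          using \<epsilon> Suc by (intro mult_right_mono power_increasing) auto
        ultimately have "(n, 2 ^ i * \<epsilon>) \<in> eps_range a b"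
          using R level_bounds[OF \<epsilon>] by (auto simp: eps_range_def)
        from growth[OF this] have "real (q n (2 ^ Suc i * \<epsilon>)) \<le> s / 2 * real (q n (2 ^ i * \<epsilon>))"
          by (simp add: mult.assoc)
        also have "\<dots> \<le> s / 2 * ((s / 2) ^ i * real (q n \<epsilon>))"
          using Suc s by (intro mult_left_mono) auto
        finally show ?case by simp
      qed simp
      from doubling_schedule_cost[of "level b \<epsilon>" q n \<epsilon> s \<rho> C k0, OF bound s]
      have "real (schedule_cost q n (L n \<epsilon>)) \<le>
          real (C * k0) * ((1 + (\<Sum>i\<le>level b \<epsilon>. real (i + 1) * s ^ i)) * q_near q \<rho> n \<epsilon>)"
        using R by (simp add: L_def)
      also have "\<dots> \<le> K * ((1 + (\<Sum>i\<le>level b \<epsilon>. real (i + 1) * s ^ i)) * q_near q \<rho> n \<epsilon>)"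
        using s by (intro mult_right_mono mult_nonneg_nonneg add_nonneg_nonneg sum_nonneg)
           (auto simp: K_def q_near_def)
      finally show ?thesis by (simp add: x)
    qed
    show "real (length (L n \<epsilon>)) \<le> K / \<epsilon>" if "\<epsilon> \<in> {0<..<1}" for n \<epsilon>
    proof (cases "(n, \<epsilon>) \<in> eps_range a b")
      case True
      note \<epsilon> = pos[OF True]
      have "2 ^ level b \<epsilon> * \<epsilon> \<le> 1" using level_bounds[OF \<epsilon>] b by linarith
      hence "real C * (2 * 2 ^ level b \<epsilon>) \<le> 2 * real C / \<epsilon>"
        using \<epsilon> mult_left_mono[of "2 ^ level b \<epsilon> * \<epsilon>" 1 "2 * real C"] by (simp add: field_simps)
      also have "\<dots> \<le> K / \<epsilon>" using \<epsilon> by (intro divide_right_mono) (auto simp: K_def)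
      finally show ?thesis using True by (simp add: L_def length_doubling_schedule)
    next
      case False
      have "real (length (L n \<epsilon>)) \<le> 5 / \<epsilon>"
        using that False length_flat_schedule[of \<epsilon> c] by (simp add: L_def)
      also have "\<dots> \<le> K / \<epsilon>" using that by (intro divide_right_mono) (auto simp: K_def)
      finally show ?thesis .
    qed
  qed
qed

text \<open>The sum is a partial sum of the derivative of the geometric series, whose terms are
  nonnegative. The bound does not depend on \<open>l\<close>, so for \<open>c > 1\<close> no
  logarithm remains.\<close>

lemma sum_Suc_power_le:
  fixes s :: real
  assumes "0 \<le> s" "s < 1"
  shows "(\<Sum>i\<le>l. real (i + 1) * s ^ i) \<le> 1 / (1 - s)\<^sup>2"
proof -
  have "(\<lambda>i. real (i + 1) * s ^ i) sums (1 / (1 - s)\<^sup>2)"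
    using geometric_deriv_sums[of s] assms by simp
  moreover from this have "(\<Sum>i\<le>l. real (i + 1) * s ^ i) \<le> (\<Sum>i. real (i + 1) * s ^ i)"
    using assms by (intro sum_le_suminf) (auto simp: sums_iff)
  ultimately show ?thesis by (simp add: sums_iff)
qed

text \<open>At \<open>s = 1\<close> the sum is quadratic in the level, and the level is at most ln
  (1 / \<open>\<epsilon>\<close>) / ln 2. The term \<open>1 / ln (1 / b)\<close> absorbs additive
  constants, because \<open>\<epsilon> \<le> b < 1\<close> keeps ln (1 / \<open>\<epsilon>\<close>)
  away from 0.\<close>

lemma sum_Suc_level_le:
  assumes "0 < \<epsilon>" "\<epsilon> \<le> b" "b < 1"
  shows "1 + (\<Sum>i\<le>level b \<epsilon>. real (i + 1) * 1 ^ i) \<le>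
           2 * (1 / ln 2 + 1 / ln (1 / b)) ^ 3 * ln (1 / \<epsilon>) ^ 3"
proof -
  define m where "m = real (level b \<epsilon>) + 1"
  have "ln (1 / b) \<le> ln (1 / \<epsilon>)" using assms by (intro ln_mono) (auto simp: field_simps)
  moreover have lnb: "0 < ln (1 / b)" using assms by simp
  ultimately have ln: "1 \<le> ln (1 / \<epsilon>) / ln (1 / b)" by simp
  have "2 ^ level b \<epsilon> * \<epsilon> \<le> 1" using level_bounds[OF assms(1,2)] assms by linarith
  hence "(2 :: real) ^ level b \<epsilon> \<le> 1 / \<epsilon>" using assms by (simp add: field_simps)
  hence "ln (2 ^ level b \<epsilon>) \<le> ln (1 / \<epsilon>)" using assms by (intro ln_mono) auto
  hence "real (level b \<epsilon>) \<le> ln (1 / \<epsilon>) / ln 2" by (simp add: ln_realpow field_simps)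
  with ln have m: "m \<le> (1 / ln 2 + 1 / ln (1 / b)) * ln (1 / \<epsilon>)"
    by (simp add: m_def algebra_simps)
  have m1: "1 \<le> m" by (simp add: m_def)
  have "(\<Sum>i\<le>level b \<epsilon>. real (i + 1) * 1 ^ i) \<le> (\<Sum>i\<le>level b \<epsilon>. m)"
    by (intro sum_mono) (auto simp: m_def)
  also have "\<dots> = m ^ 2" by (simp add: m_def power2_eq_square algebra_simps)
  finally have "1 + (\<Sum>i\<le>level b \<epsilon>. real (i + 1) * 1 ^ i) \<le> 1 + m ^ 2" by simp
  \<comment> \<open>Since \<open>m\<close> is at least 1, both summands are at most the cube that
    the claimed complexity allows.\<close>
  also have "\<dots> \<le> 2 * m ^ 3"
    using one_le_power[OF m1, of 3] power_increasing[OF _ m1, of 2 3] by linarith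
  also have "\<dots> \<le> 2 * ((1 / ln 2 + 1 / ln (1 / b)) * ln (1 / \<epsilon>)) ^ 3"
    using m m1 by (intro mult_left_mono power_mono) auto
  finally show ?thesis by (simp add: power_mult_distrib)
qed

text \<open>The cost ratio of consecutive levels is \<open>s = 2 powr (1 - c)\<close>, apart from
  the linear factor. For \<open>c > 1\<close> it is below 1 and the levels sum to a constant; for
  \<open>c = 1\<close> it is 1 and the number of levels enters.\<close>

lemma doho_testable_q_near:
  assumes T: "string_tester \<Phi> q T" and \<Phi>: "\<And>n. \<Phi> n \<subseteq> strings n"
    and a: "0 < a" and b: "0 < b" "b < 1" and \<rho>: "0 < \<rho>" "\<rho> < 1"
    and growth: "\<forall>(n, \<epsilon>)\<in>eps_range a b. real (q n \<epsilon>) \<ge> 2 powr c * real (q n (2 * \<epsilon>))"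
  shows "c > 1 \<Longrightarrow> doho_testable (supported_dists \<Phi>) (eps_range a b) (q_near q \<rho>)"
    and "c = 1 \<Longrightarrow> doho_testable (supported_dists \<Phi>) (eps_range a b)
           (\<lambda>n \<epsilon>. ln (1 / \<epsilon>) ^ 3 * q_near q \<rho> n \<epsilon>)"
proof -
  define s where "s = (2 :: real) powr (1 - c)"
  have s: "s > 0" by (simp add: s_def)
  have half: "s / 2 = 1 / 2 powr c" by (simp add: s_def powr_diff)
  have "real (q n (2 * \<epsilon>)) \<le> s / 2 * real (q n \<epsilon>)" if "(n, \<epsilon>) \<in> eps_range a b" for n \<epsilon>
    using growth that unfolding half by (auto simp: field_simps)
  note testable = doho_testable_doubling[OF T \<Phi> a b \<rho> s this]
  have near: "q_near q \<rho> n \<epsilon> \<ge> 0" for n \<epsilon> by (simp add: q_near_def)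
  have nonneg: "0 \<le> (1 + (\<Sum>i\<le>level b \<epsilon>. real (i + 1) * s ^ i)) * q_near q \<rho> n \<epsilon>" for n \<epsilon>
    using s near by (intro mult_nonneg_nonneg add_nonneg_nonneg sum_nonneg) auto
  show "doho_testable (supported_dists \<Phi>) (eps_range a b) (q_near q \<rho>)" if "c > 1"
  proof (rule doho_testable_mono[OF testable])
    fix n \<epsilon>
    have "s < 2 powr 0" unfolding s_def using that by (intro powr_less_mono) auto
    hence "1 + (\<Sum>i\<le>level b \<epsilon>. real (i + 1) * s ^ i) \<le> 1 + 1 / (1 - s)\<^sup>2"
      using s by (intro add_left_mono sum_Suc_power_le) auto
    thus "0 \<le> (1 + (\<Sum>i\<le>level b \<epsilon>. real (i + 1) * s ^ i)) * q_near q \<rho> n \<epsilon> \<and>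
        (1 + (\<Sum>i\<le>level b \<epsilon>. real (i + 1) * s ^ i)) * q_near q \<rho> n \<epsilon> \<le>
        (1 + 1 / (1 - s)\<^sup>2) * q_near q \<rho> n \<epsilon>"
      using near nonneg by (blast intro: mult_right_mono)
  qed (auto intro: near)
  show "doho_testable (supported_dists \<Phi>) (eps_range a b)
           (\<lambda>n \<epsilon>. ln (1 / \<epsilon>) ^ 3 * q_near q \<rho> n \<epsilon>)" if "c = 1"
  proof (rule doho_testable_mono[OF testable])
    fix n \<epsilon> assume R: "(n, \<epsilon>) \<in> eps_range a b"
    have "0 < a / real n" using R a by (auto simp: eps_range_def)
    hence \<epsilon>: "0 < \<epsilon>" "\<epsilon> \<le> b" using R by (auto simp: eps_range_def)
    show "0 \<le> ln (1 / \<epsilon>) ^ 3 * q_near q \<rho> n \<epsilon>"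
      using \<epsilon> b near by (intro mult_nonneg_nonneg zero_le_power) auto
    have "s = 1" using that by (simp add: s_def)
    with sum_Suc_level_le[OF \<epsilon> b(2)]
    have "1 + (\<Sum>i\<le>level b \<epsilon>. real (i + 1) * s ^ i) \<le>
        2 * (1 / ln 2 + 1 / ln (1 / b)) ^ 3 * ln (1 / \<epsilon>) ^ 3" by simp
    hence "(1 + (\<Sum>i\<le>level b \<epsilon>. real (i + 1) * s ^ i)) * q_near q \<rho> n \<epsilon> \<le>
        2 * (1 / ln 2 + 1 / ln (1 / b)) ^ 3 * ln (1 / \<epsilon>) ^ 3 * q_near q \<rho> n \<epsilon>"
      using near by (rule mult_right_mono)
    thus "0 \<le> (1 + (\<Sum>i\<le>level b \<epsilon>. real (i + 1) * s ^ i)) * q_near q \<rho> n \<epsilon> \<and>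
        (1 + (\<Sum>i\<le>level b \<epsilon>. real (i + 1) * s ^ i)) * q_near q \<rho> n \<epsilon> \<le>
        2 * (1 / ln 2 + 1 / ln (1 / b)) ^ 3 * (ln (1 / \<epsilon>) ^ 3 * q_near q \<rho> n \<epsilon>)"
      using nonneg[of \<epsilon> n] by (simp only: mult.assoc)
  qed
qed

lemma q_near_le:
  assumes "real (q n (\<rho> * \<epsilon>)) \<le> L * real (q n \<epsilon>)"
  shows "q_near q \<rho> n \<epsilon> \<le> max 1 L * real (q n \<epsilon>)"
proof -
  have "1 * real (q n \<epsilon>) \<le> max 1 L * real (q n \<epsilon>)" "L * real (q n \<epsilon>) \<le> max 1 L * real (q n \<epsilon>)"
    by (intro mult_right_mono; simp)+
  thus ?thesis using assms by (simp add: q_near_def)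
qed

theorem theoremA2:
  fixes \<Phi> :: "nat \<Rightarrow> bool list set" and q :: "nat \<Rightarrow> real \<Rightarrow> nat"
  assumes "\<And>n. \<Phi> n \<subseteq> strings n"
    and "\<exists>T. string_tester \<Phi> q T"
  shows "(\<exists>k::nat. doho_testable (supported_dists \<Phi>) {(n, \<epsilon>). n > 0 \<and> 0 < \<epsilon> \<and> \<epsilon> < 1}
           (\<lambda>n \<epsilon>. 1 / \<epsilon> * (1 + ln (1 / \<epsilon>)) ^ k * real (q n (\<epsilon> / 2)))) \<and>
    (\<forall>a b c :: real. 0 < a \<and> 0 < b \<and> b < 1 \<and> c \<ge> 1 \<and>
       (\<forall>(n, \<epsilon>)\<in>eps_range a b. real (q n \<epsilon>) \<ge> 2 powr c * real (q n (2 * \<epsilon>))) \<longrightarrow>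
      (\<forall>\<rho>\<in>{0<..<1}.
         (c > 1 \<longrightarrow> doho_testable (supported_dists \<Phi>) (eps_range a b) (q_near q \<rho>)) \<and>
         (c = 1 \<longrightarrow> doho_testable (supported_dists \<Phi>) (eps_range a b)
                     (\<lambda>n \<epsilon>. ln (1 / \<epsilon>) ^ 3 * q_near q \<rho> n \<epsilon>))) \<and>
      ((\<exists>\<rho>\<in>{0<..<1}. \<exists>L. \<forall>(n, \<epsilon>)\<in>eps_range a b. real (q n (\<rho> * \<epsilon>)) \<le> L * real (q n \<epsilon>)) \<longrightarrow>
         (c > 1 \<longrightarrow> doho_testable (supported_dists \<Phi>) (eps_range a b) (\<lambda>n \<epsilon>. real (q n \<epsilon>))) \<and>
         (c = 1 \<longrightarrow> doho_testable (supported_dists \<Phi>) (eps_range a b)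
                     (\<lambda>n \<epsilon>. ln (1 / \<epsilon>) ^ 3 * real (q n \<epsilon>)))))"
proof (intro conjI allI impI ballI)
  obtain T where T: "string_tester \<Phi> q T" using assms(2) by blast
  note \<Phi> = assms(1)
  show "\<exists>k::nat. doho_testable (supported_dists \<Phi>) {(n, \<epsilon>). n > 0 \<and> 0 < \<epsilon> \<and> \<epsilon> < 1}
           (\<lambda>n \<epsilon>. 1 / \<epsilon> * (1 + ln (1 / \<epsilon>)) ^ k * real (q n (\<epsilon> / 2)))"
    \<comment> \<open>A single power of the logarithm, \<open>k = 1\<close>, is the witness.\<close>
    using doho_testable_flat[OF T \<Phi>] by blast
  fix a b c :: real
  assume abc: "0 < a \<and> 0 < b \<and> b < 1 \<and> c \<ge> 1 \<and>
       (\<forall>(n, \<epsilon>)\<in>eps_range a b. real (q n \<epsilon>) \<ge> 2 powr c * real (q n (2 * \<epsilon>)))"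
  hence a: "0 < a" and b: "0 < b" "b < 1"
    and growth: "\<forall>(n, \<epsilon>)\<in>eps_range a b. real (q n \<epsilon>) \<ge> 2 powr c * real (q n (2 * \<epsilon>))"
    by blast+
  note near = doho_testable_q_near[OF T \<Phi> a b _ _ growth]
  {
    fix \<rho> :: real assume "\<rho> \<in> {0<..<1}"
    hence \<rho>: "0 < \<rho>" "\<rho> < 1" by auto
    show "doho_testable (supported_dists \<Phi>) (eps_range a b) (q_near q \<rho>)" if "c > 1"
      using near(1)[OF \<rho> that] .
    show "doho_testable (supported_dists \<Phi>) (eps_range a b)
        (\<lambda>n \<epsilon>. ln (1 / \<epsilon>) ^ 3 * q_near q \<rho> n \<epsilon>)" if "c = 1"
      using near(2)[OF \<rho> that] .
  }
  assume "\<exists>\<rho>\<in>{0<..<1}. \<exists>L. \<forall>(n, \<epsilon>)\<in>eps_range a b. real (q n (\<rho> * \<epsilon>)) \<le> L * real (q n \<epsilon>)"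
  then obtain \<rho> L where \<rho>: "0 < \<rho>" "\<rho> < 1"
    and "\<forall>(n, \<epsilon>)\<in>eps_range a b. real (q n (\<rho> * \<epsilon>)) \<le> L * real (q n \<epsilon>)" by auto
  hence le: "q_near q \<rho> n \<epsilon> \<le> max 1 L * real (q n \<epsilon>)" if "(n, \<epsilon>) \<in> eps_range a b" for n \<epsilon>
    using that by (intro q_near_le) auto
  have nonneg: "q_near q \<rho> n \<epsilon> \<ge> 0" for n \<epsilon> by (simp add: q_near_def)
  show "doho_testable (supported_dists \<Phi>) (eps_range a b) (\<lambda>n \<epsilon>. real (q n \<epsilon>))" if "c > 1"
    using le nonneg by (intro doho_testable_mono[OF near(1)[OF \<rho> that]]) auto
  show "doho_testable (supported_dists \<Phi>) (eps_range a b) (\<lambda>n \<epsilon>. ln (1 / \<epsilon>) ^ 3 * real (q n \<epsilon>))"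
    if "c = 1"
  proof (rule doho_testable_mono[OF near(2)[OF \<rho> that]])
    fix n \<epsilon> assume R: "(n, \<epsilon>) \<in> eps_range a b"
    have "0 < a / real n" using R a by (auto simp: eps_range_def)
    hence "0 < \<epsilon>" "\<epsilon> < 1" using R b by (auto simp: eps_range_def)
    hence ln: "ln (1 / \<epsilon>) ^ 3 \<ge> 0" by simp
    show "0 \<le> ln (1 / \<epsilon>) ^ 3 * real (q n \<epsilon>)" using ln by simp
    show "0 \<le> ln (1 / \<epsilon>) ^ 3 * q_near q \<rho> n \<epsilon> \<and>
        ln (1 / \<epsilon>) ^ 3 * q_near q \<rho> n \<epsilon> \<le> max 1 L * (ln (1 / \<epsilon>) ^ 3 * real (q n \<epsilon>))"
      using mult_left_mono[OF le[OF R] ln] mult_nonneg_nonneg[OF ln nonneg[of n \<epsilon>]]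
      by (simp only: mult.left_commute)
  qed
qed

end
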